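(* Let $W$ be a channel from a finite set $\mathcal X$ to a finite set $\mathcal Y$, let $p$ be a probability distribution on $\mathcal X$, and let $R$ be a real number. Then $$e_\epsilon(R|W,p)\ge\max_{0\le s\le1}\frac{-\psi(s|W,p)+sR}{1+s},\qquad e_D(R|W,p)\ge\max_{-1/2\le t\le0}\{-\phi(t|W,p)-tR\},$$ $$e_\epsilon(R|W)\ge\max_{0\le s\le1}\frac{-\psi(s|W)+sR}{1+s},\qquad e_D(R|W)\ge\max_{-1/2\le t\le0}\{-\max_p\phi(t|W,p)-tR\}.$$
   Context: A channel $W$ assigns to each $x\in\mathcal X$ a distribution $W_x$ on $\mathcal Y$; $W_p(y)=\sum_xp(x)W_x(y)$. Its $n$-fold memoryless extension is $W^n_{x^n}(y^n)=\prod_iW_{x_i}(y_i)$, and $p^n$ is the $n$-fold product of $p$. A resolvability code $\Psi$ of size $|\Psi|=M$ for a channel $V$ is a tuple $(x_1,\dots,x_M)$ of inputs; $\epsilon(\Psi,V_q):=\sum_y|\frac1M\sum_iV_{x_i}(y)-V_q(y)|$ and $D(\Psi,V_q):=D(\frac1M\sum_iV_{x_i}\|V_q)$ with $D(a\|b)=\sum a\log(a/b)$. For real $M>0$, $\epsilon(M,V):=\max_q\min_{\Psi:|\Psi|\le M}\epsilon(\Psi,V_q)$ and $D(M,V):=\max_q\min_{\Psi:|\Psi|\le M}D(\Psi,V_q)$, maxima over all input distributions $q$. Exponents: $e_\epsilon(R|W,p):=\sup\{\liminf_n-\frac1n\log\epsilon(\Psi_n,W^n_{p^n})\}$ and $e_D(R|W,p):=\sup\{\liminf_n-\frac1n\log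 D(\Psi_n,W^n_{p^n})\}$, suprema over sequences $\{\Psi_n\}$ of resolvability codes for $W^n$ with $\limsup_n\frac1n\log|\Psi_n|\le R$; $e_\epsilon(R|W):=\liminf_n-\frac1n\log\epsilon(e^{nR},W^n)$ and $e_D(R|W):=\liminf_n-\frac1n\log D(e^{nR},W^n)$. Functions: $\phi(t|W,p):=\log\sum_y\big(\sum_xp(x)W_x(y)^{1/(1+t)}\big)^{1+t}$; $\psi(s|W,p):=\log\sum_xp(x)\sum_yW_x(y)^{1+s}W_p(y)^{-s}$; $\psi(s|W):=\log\max_p\sum_y\big(\sum_xp(x)W_x(y)^{1+s}\big)^{1-s}$.
   Formalization: The rate R is assumed nonnegative: for R < 0 no resolvability code meets the size constraint, so the exponents are suprema or minima over empty sets, while the right-hand sides are at least 0. *)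

theory Defs
  imports "HOL-Analysis.Analysis"
begin

definition channel :: "('x \<Rightarrow> 'y::finite \<Rightarrow> real) \<Rightarrow> bool" where
  "channel W \<longleftrightarrow> (\<forall>x y. 0 \<le> W x y) \<and> (\<forall>x. (\<Sum>y\<in>UNIV. W x y) = 1)"

text \<open>Probability distributions on a finite set A (values outside A are irrelevant).\<close>
definition dists :: "'a set \<Rightarrow> ('a \<Rightarrow> real) set" where
  "dists A = {q. (\<forall>x\<in>A. 0 \<le> q x) \<and> sum q A = 1}"

definition seqs :: "nat \<Rightarrow> 'a list set" where
  "seqs n = {xs. length xs = n}"

definition Wn :: "('x \<Rightarrow> 'y \<Rightarrow> real) \<Rightarrow> 'x list \<Rightarrow> 'y list \<Rightarrow> real" where
  "Wn W xs ys = (\<Prod>i<length xs. W (xs ! i) (ys ! i))"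

definition pn :: "('x \<Rightarrow> real) \<Rightarrow> 'x list \<Rightarrow> real" where
  "pn p xs = (\<Prod>i<length xs. p (xs ! i))"

definition outdist :: "'a set \<Rightarrow> ('a \<Rightarrow> 'b \<Rightarrow> real) \<Rightarrow> ('a \<Rightarrow> real) \<Rightarrow> 'b \<Rightarrow> real" where
  "outdist A V q y = (\<Sum>x\<in>A. q x * V x y)"

text \<open>A resolvability code is a nonempty tuple (list) of inputs; its induced output
  distribution is the uniform mixture (1/M) sum_i V_{x_i}.\<close>
definition code_avg :: "('a \<Rightarrow> 'b \<Rightarrow> real) \<Rightarrow> 'a list \<Rightarrow> 'b \<Rightarrow> real" where
  "code_avg V \<Psi> y = (\<Sum>x\<leftarrow>\<Psi>. V x y) / real (length \<Psi>)"

definition codes :: "'a set \<Rightarrow> real \<Rightarrow> 'a list set" where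
  "codes A M = {\<Psi>. \<Psi> \<noteq> [] \<and> set \<Psi> \<subseteq> A \<and> real (length \<Psi>) \<le> M}"

definition eps_code :: "'b set \<Rightarrow> ('a \<Rightarrow> 'b \<Rightarrow> real) \<Rightarrow> 'a list \<Rightarrow> ('b \<Rightarrow> real) \<Rightarrow> real" where
  "eps_code B V \<Psi> r = (\<Sum>y\<in>B. \<bar>code_avg V \<Psi> y - r y\<bar>)"

definition KL :: "'b set \<Rightarrow> ('b \<Rightarrow> real) \<Rightarrow> ('b \<Rightarrow> real) \<Rightarrow> ereal" where
  "KL B a b = (if \<exists>y\<in>B. 0 < a y \<and> b y = 0 then \<infinity>
               else ereal (\<Sum>y\<in>B. if a y = 0 then 0 else a y * ln (a y / b y)))"

definition D_code :: "'b set \<Rightarrow> ('a \<Rightarrow> 'b \<Rightarrow> real) \<Rightarrow> 'a list \<Rightarrow> ('b \<Rightarrow> real) \<Rightarrow> ereal" where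
  "D_code B V \<Psi> r = KL B (code_avg V \<Psi>) r"

definition eps_M :: "'a set \<Rightarrow> 'b set \<Rightarrow> ('a \<Rightarrow> 'b \<Rightarrow> real) \<Rightarrow> real \<Rightarrow> ereal" where
  "eps_M A B V M = (SUP q\<in>dists A. INF \<Psi>\<in>codes A M. ereal (eps_code B V \<Psi> (outdist A V q)))"

definition D_M :: "'a set \<Rightarrow> 'b set \<Rightarrow> ('a \<Rightarrow> 'b \<Rightarrow> real) \<Rightarrow> real \<Rightarrow> ereal" where
  "D_M A B V M = (SUP q\<in>dists A. INF \<Psi>\<in>codes A M. D_code B V \<Psi> (outdist A V q))"

definition rate :: "nat \<Rightarrow> ereal \<Rightarrow> ereal" where
  "rate n x = (if x = 0 then \<infinity> else if x = \<infinity> then -\<infinity>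
               else ereal (- ln (real_of_ereal x) / real n))"

definition code_seqs :: "real \<Rightarrow> (nat \<Rightarrow> 'x list list) set" where
  "code_seqs R = {\<Psi>. (\<forall>n. \<Psi> n \<noteq> [] \<and> set (\<Psi> n) \<subseteq> seqs n) \<and>
      limsup (\<lambda>n. ereal (ln (real (length (\<Psi> n))) / real n)) \<le> ereal R}"

definition e_eps_p :: "real \<Rightarrow> ('x::finite \<Rightarrow> 'y::finite \<Rightarrow> real) \<Rightarrow> ('x \<Rightarrow> real) \<Rightarrow> ereal" where
  "e_eps_p R W p = (SUP \<Psi>\<in>code_seqs R.
     liminf (\<lambda>n. rate n (ereal (eps_code (seqs n) (Wn W) (\<Psi> n) (outdist (seqs n) (Wn W) (pn p))))))"

definition e_D_p :: "real \<Rightarrow> ('x::finite \<Rightarrow> 'y::finite \<Rightarrow> real) \<Rightarrow> ('x \<Rightarrow> real) \<Rightarrow> ereal" where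
  "e_D_p R W p = (SUP \<Psi>\<in>code_seqs R.
     liminf (\<lambda>n. rate n (D_code (seqs n) (Wn W) (\<Psi> n) (outdist (seqs n) (Wn W) (pn p)))))"

definition e_eps :: "real \<Rightarrow> ('x::finite \<Rightarrow> 'y::finite \<Rightarrow> real) \<Rightarrow> ereal" where
  "e_eps R W = liminf (\<lambda>n. rate n (eps_M (seqs n) (seqs n) (Wn W) (exp (real n * R))))"

definition e_D :: "real \<Rightarrow> ('x::finite \<Rightarrow> 'y::finite \<Rightarrow> real) \<Rightarrow> ereal" where
  "e_D R W = liminf (\<lambda>n. rate n (D_M (seqs n) (seqs n) (Wn W) (exp (real n * R))))"

definition Wp :: "('x::finite \<Rightarrow> 'y \<Rightarrow> real) \<Rightarrow> ('x \<Rightarrow> real) \<Rightarrow> 'y \<Rightarrow> real" where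
  "Wp W p y = (\<Sum>x\<in>UNIV. p x * W x y)"

definition phi :: "real \<Rightarrow> ('x::finite \<Rightarrow> 'y::finite \<Rightarrow> real) \<Rightarrow> ('x \<Rightarrow> real) \<Rightarrow> real" where
  "phi t W p = ln (\<Sum>y\<in>UNIV. (\<Sum>x\<in>UNIV. p x * W x y powr (1 / (1 + t))) powr (1 + t))"

definition psi_p :: "real \<Rightarrow> ('x::finite \<Rightarrow> 'y::finite \<Rightarrow> real) \<Rightarrow> ('x \<Rightarrow> real) \<Rightarrow> real" where
  "psi_p s W p = ln (\<Sum>x\<in>UNIV. p x * (\<Sum>y\<in>UNIV. W x y powr (1 + s) * Wp W p y powr (- s)))"

definition psi :: "real \<Rightarrow> ('x::finite \<Rightarrow> 'y::finite \<Rightarrow> real) \<Rightarrow> real" where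
  "psi s W = ln (Sup ((\<lambda>p. \<Sum>y\<in>UNIV. (\<Sum>x\<in>UNIV. p x * W x y powr (1 + s)) powr (1 - s))
                       ` dists (UNIV :: 'x set)))"

end

theory Submission
  imports Defs
begin

text \<open>
  Draw the \<open>M\<close> codewords independently from \<open>q\<close> and treat each output \<open>y\<close> separately. With
  \<open>T = \<Sum>x. q x * V x y powr (1 / (1 - u))\<close>, truncation and the second moment bound the expected
  deviation at \<open>y\<close> by \<open>3 M powr - u * T powr (1 - u)\<close> for \<open>u \<le> 1/2\<close>. For the relative entropy,
  Jensen's inequality over all codewords but one replaces the code average inside the logarithm by
  \<open>V x y / M + w\<close>, where \<open>w\<close> is the output probability; \<open>ln (1 + z) \<le> z powr u / u\<close> and
  Hoelder's inequality then give \<open>M powr - u * T powr (1 - u) / u\<close>. Summed over \<open>y\<close>, both bounds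
  are governed by \<open>exp (phi (- u) V q)\<close>, which is multiplicative for product inputs and whose
  supremum over all inputs is submultiplicative. For \<open>u = s / (1 + s)\<close>, Hoelder's inequality and
  \<open>W x y \<le> 1\<close> bound it by the two functions \<open>psi\<close>.
\<close>

section \<open>Elementary inequalities\<close>

text \<open>Dividing by the two sums reduces each term to weighted AM-GM, and the weights
  \<open>1 - u\<close> and \<open>u\<close> add up to 1. Vanishing sums are split off because they
  cannot be divided by.\<close>

lemma holder_powr:
  fixes x y :: "'i \<Rightarrow> real"
  assumes "finite I" and x: "\<And>i. i \<in> I \<Longrightarrow> 0 \<le> x i" and y: "\<And>i. i \<in> I \<Longrightarrow> 0 \<le> y i"
    and u: "0 \<le> u" "u \<le> 1"
  shows "(\<Sum>i\<in>I. x i powr (1 - u) * y i powr u) \<le> sum x I powr (1 - u) * sum y I powr u"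
proof (cases "sum x I = 0 \<or> sum y I = 0")
  case True
  then have "(\<forall>i\<in>I. x i = 0) \<or> (\<forall>i\<in>I. y i = 0)"
    using assms by (simp add: sum_nonneg_eq_0_iff)
  then have "(\<Sum>i\<in>I. x i powr (1 - u) * y i powr u) = 0"
    by (auto intro!: sum.neutral)
  then show ?thesis by simp
next
  case False
  define X where "X = sum x I"
  define Y where "Y = sum y I"
  have XY: "0 < X" "0 < Y"
    using False x y by (auto simp: X_def Y_def less_le intro: sum_nonneg)
  have "x i powr (1 - u) * y i powr u \<le> X powr (1 - u) * Y powr u * ((1 - u) * (x i / X) + u * (y i / Y))"
    if "i \<in> I" for i
  proof -
    have nn: "0 \<le> x i" "0 \<le> y i" using x y that by auto
    have "(x i / X) powr (1 - u) * (y i / Y) powr u \<le> (1 - u) * (x i / X) + u * (y i / Y)"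
    proof (cases "x i = 0 \<or> y i = 0")
      case True
      then show ?thesis using nn XY u by auto
    next
      case False
      then have "0 < x i / X" "0 < y i / Y" using nn XY by auto
      then show ?thesis using u by (intro Youngs_inequality_0) auto
    qed
    then show ?thesis
      using XY nn by (simp add: powr_divide field_simps)
  qed
  then have "(\<Sum>i\<in>I. x i powr (1 - u) * y i powr u)
      \<le> (\<Sum>i\<in>I. X powr (1 - u) * Y powr u * ((1 - u) * (x i / X) + u * (y i / Y)))"
    by (rule sum_mono)
  also have "\<dots> = X powr (1 - u) * Y powr u * ((1 - u) * (X / X) + u * (Y / Y))"
    unfolding X_def Y_def
    by (simp add: sum_distrib_left[symmetric] sum.distrib sum_divide_distrib[symmetric])
  also have "\<dots> = X powr (1 - u) * Y powr u" using XY by simp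
  finally show ?thesis by (simp add: X_def Y_def)
qed

lemma ln_one_plus_le_powr:
  fixes z u :: real
  assumes "0 \<le> z" "0 < u" "u \<le> 1"
  shows "ln (1 + z) \<le> z powr u / u"
proof -
  have le: "a \<le> a powr u" if "0 \<le> a" "a \<le> 1" for a :: real
    using powr_mono'[of u 1 a] that assms by simp
  \<comment> \<open>Both fractions lie in [0,1] and add up to 1, and a power at most 1 only
    increases them; this is subadditivity of \<open>powr u\<close>.\<close>
  have "1 = 1 / (1 + z) + z / (1 + z)"
    using assms by (simp add: field_simps)
  also have "\<dots> \<le> (1 / (1 + z)) powr u + (z / (1 + z)) powr u"
    using assms by (intro add_mono le) auto
  also have "\<dots> = (1 + z powr u) / (1 + z) powr u"
    using assms by (simp add: powr_divide add_divide_distrib)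
  finally have "(1 + z) powr u \<le> 1 + z powr u"
    using assms by (simp add: field_simps)
  then have "ln ((1 + z) powr u) \<le> ln (1 + z powr u)"
    using assms by (subst ln_le_cancel_iff) (auto simp: add_pos_nonneg)
  also have "\<dots> \<le> z powr u" by (intro ln_add_one_self_le_self) auto
  finally show ?thesis using assms by (simp add: ln_powr field_simps)
qed

section \<open>Random codes\<close>

lemma distsD:
  assumes "q \<in> dists A"
  shows "\<And>x. x \<in> A \<Longrightarrow> 0 \<le> q x" "sum q A = 1" "finite A" "A \<noteq> {}"
  using assms by (auto simp: dists_def intro: ccontr)

text \<open>The mean over \<open>m\<close> independent draws from \<open>q\<close>, by recursion on
  the first codeword: finite sums suffice, and each property becomes an induction on
  \<open>m\<close>.\<close>

primrec code_expectation :: "'a set \<Rightarrow> ('a \<Rightarrow> real) \<Rightarrow> nat \<Rightarrow> ('a list \<Rightarrow> real) \<Rightarrow> real" where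
  "code_expectation A q 0 f = f []"
| "code_expectation A q (Suc m) f = (\<Sum>x\<in>A. q x * code_expectation A q m (\<lambda>xs. f (x # xs)))"

lemma code_expectation_mono:
  assumes q: "q \<in> dists A"
    and "\<And>xs. length xs = m \<Longrightarrow> set xs \<subseteq> A \<Longrightarrow> f xs \<le> g xs"
  shows "code_expectation A q m f \<le> code_expectation A q m g"
  using assms(2)
proof (induction m arbitrary: f g)
  case (Suc m)
  show ?case
    unfolding code_expectation.simps
    by (intro sum_mono mult_left_mono Suc.IH distsD(1)[OF q]) (simp add: Suc.prems)
qed simp

lemma code_expectation_add:
  "code_expectation A q m (\<lambda>xs. f xs + g xs) = code_expectation A q m f + code_expectation A q m g"
  by (induction m arbitrary: f g) (simp_all add: distrib_left sum.distrib)

lemma code_expectation_cmult: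
  "code_expectation A q m (\<lambda>xs. c * f xs) = c * code_expectation A q m f"
  by (induction m arbitrary: f) (simp_all add: sum_distrib_left mult_ac)

lemma code_expectation_const:
  assumes "q \<in> dists A"
  shows "code_expectation A q m (\<lambda>_. c) = c"
  using distsD(2)[OF assms] by (induction m) (simp_all add: sum_distrib_right[symmetric])

lemma code_expectation_sum:
  "code_expectation A q m (\<lambda>xs. \<Sum>i\<in>I. f i xs) = (\<Sum>i\<in>I. code_expectation A q m (f i))"
  by (induction m arbitrary: f)
    (simp_all add: sum_distrib_left sum.swap[of _ I])

text \<open>A minimum over the support is at most the mean, applied one codeword at a time. Keeping
  the codewords in the support is what later makes the relative entropy finite.\<close>

lemma exists_code_le_expectation:
  assumes q: "q \<in> dists A"
  shows "\<exists>xs. length xs = m \<and> set xs \<subseteq> {x \<in> A. 0 < q x} \<and> f xs \<le> code_expectation A q m f"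
proof (induction m arbitrary: f)
  case (Suc m)
  define e where "e = (\<lambda>x. code_expectation A q m (\<lambda>xs. f (x # xs)))"
  have "\<exists>x\<in>A. 0 < q x \<and> e x \<le> code_expectation A q (Suc m) f"
  proof (rule ccontr)
    assume "\<not> ?thesis"
    then have less: "code_expectation A q (Suc m) f < e x" if "x \<in> A" "0 < q x" for x
      using that by force
    obtain x where x: "x \<in> A" "0 < q x"
      using distsD[OF q] by (metis less_le sum.neutral zero_neq_one)
    \<comment> \<open>If every letter of the support lay strictly above the mean, so would their
      \<open>q\<close>-average.\<close>
    have "(\<Sum>x\<in>A. q x * code_expectation A q (Suc m) f) < (\<Sum>x\<in>A. q x * e x)"
    proof (rule sum_strict_mono_ex1)
      show "\<forall>x\<in>A. q x * code_expectation A q (Suc m) f \<le> q x * e x"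
        using less distsD(1)[OF q] by (metis less_le mult_left_mono mult_zero_left order_refl)
      show "\<exists>x\<in>A. q x * code_expectation A q (Suc m) f < q x * e x"
        using x less by (auto intro!: bexI[of _ x])
    qed (rule distsD(3)[OF q])
    then show False
      using distsD(2)[OF q] by (simp add: sum_distrib_right[symmetric] e_def)
  qed
  then obtain x where x: "x \<in> A" "0 < q x" "e x \<le> code_expectation A q (Suc m) f" by blast
  obtain xs where "length xs = m" "set xs \<subseteq> {x \<in> A. 0 < q x}" "f (x # xs) \<le> e x"
    using Suc.IH[of "\<lambda>xs. f (x # xs)"] by (auto simp: e_def)
  then show ?case using x by (intro exI[of _ "x # xs"]) auto
qed simp

section \<open>Moments and mean deviation of a random code\<close>

lemma code_expectation_sum_list:
  assumes q: "q \<in> dists A"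
  shows "code_expectation A q m (\<lambda>xs. \<Sum>x\<leftarrow>xs. g x) = real m * (\<Sum>x\<in>A. q x * g x)"
proof (induction m)
  case (Suc m)
  have "code_expectation A q (Suc m) (\<lambda>xs. \<Sum>x\<leftarrow>xs. g x)
      = (\<Sum>x\<in>A. q x * (g x + real m * (\<Sum>x\<in>A. q x * g x)))"
    by (simp add: code_expectation_add code_expectation_const[OF q] Suc.IH)
  also have "\<dots> = (\<Sum>x\<in>A. q x * g x) + (\<Sum>x\<in>A. q x) * (real m * (\<Sum>x\<in>A. q x * g x))"
    by (simp add: distrib_left sum.distrib sum_distrib_right)
  finally show ?case using distsD(2)[OF q] by (simp add: algebra_simps)
qed simp

text \<open>Independent centred summands have vanishing cross terms, so only the diagonal
  contributes.\<close>

lemma code_expectation_square_centered: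
  assumes q: "q \<in> dists A" and g: "(\<Sum>x\<in>A. q x * g x) = 0"
  shows "code_expectation A q m (\<lambda>xs. (\<Sum>x\<leftarrow>xs. g x)\<^sup>2) = real m * (\<Sum>x\<in>A. q x * (g x)\<^sup>2)"
proof (induction m)
  case (Suc m)
  have "code_expectation A q (Suc m) (\<lambda>xs. (\<Sum>x\<leftarrow>xs. g x)\<^sup>2)
      = (\<Sum>x\<in>A. q x * code_expectation A q m
          (\<lambda>xs. (g x)\<^sup>2 + ((\<Sum>x\<leftarrow>xs. g x)\<^sup>2 + 2 * g x * (\<Sum>x\<leftarrow>xs. g x))))"
    by (simp add: power2_sum add.assoc)
  also have "\<dots> = (\<Sum>x\<in>A. q x * ((g x)\<^sup>2 + real m * (\<Sum>x\<in>A. q x * (g x)\<^sup>2)))"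
    by (simp only: code_expectation_add code_expectation_const[OF q] code_expectation_cmult
        code_expectation_sum_list[OF q] g Suc.IH) simp
  also have "\<dots> = (\<Sum>x\<in>A. q x * (g x)\<^sup>2) + (\<Sum>x\<in>A. q x) * (real m * (\<Sum>x\<in>A. q x * (g x)\<^sup>2))"
    by (simp add: distrib_left sum.distrib sum_distrib_right)
  finally show ?case using distsD(2)[OF q] by (simp add: algebra_simps)
qed simp

text \<open>Splitting each letter at the threshold \<open>(T m) powr (1 - u)\<close> balances the variance of the
  truncated part against the mass of the tail.\<close>

lemma code_expectation_abs_deviation_le:
  assumes q: "q \<in> dists A" and g: "\<And>x. x \<in> A \<Longrightarrow> 0 \<le> g x"
    and m: "0 < m" and u: "0 \<le> u" "u \<le> 1/2"
    and T_def: "T = (\<Sum>x\<in>A. q x * g x powr (1 / (1 - u)))"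
    and w_def: "w = (\<Sum>x\<in>A. q x * g x)"
  shows "code_expectation A q m (\<lambda>xs. \<bar>(\<Sum>x\<leftarrow>xs. g x) / real m - w\<bar>)
    \<le> 3 * (real m powr - u * T powr (1 - u))"
proof (cases "T = 0")
  note q0 = distsD(1)[OF q] and fin = distsD(3)[OF q]
  case True
  \<comment> \<open>\<open>T = 0\<close> forces \<open>g\<close> to vanish wherever \<open>q\<close>
    is positive; then \<open>w = 0\<close>, and the deviation is the code average itself, of mean
    0.\<close>
  then have "\<forall>x\<in>A. q x * g x powr (1 / (1 - u)) = 0"
    unfolding T_def using q0 fin by (subst (asm) sum_nonneg_eq_0_iff) auto
  then have "w = 0" unfolding w_def by (intro sum.neutral) auto
  have "code_expectation A q m (\<lambda>xs. \<bar>(\<Sum>x\<leftarrow>xs. g x) / real m - w\<bar>)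
      \<le> code_expectation A q m (\<lambda>xs. (1 / real m) * (\<Sum>x\<leftarrow>xs. g x))"
  proof (rule code_expectation_mono[OF q])
    fix xs assume "set xs \<subseteq> A"
    then have "0 \<le> (\<Sum>x\<leftarrow>xs. g x)" by (intro sum_list_nonneg) (auto intro: g)
    then show "\<bar>(\<Sum>x\<leftarrow>xs. g x) / real m - w\<bar> \<le> (1 / real m) * (\<Sum>x\<leftarrow>xs. g x)"
      using \<open>w = 0\<close> by simp
  qed
  also have "\<dots> = 0"
    unfolding code_expectation_cmult code_expectation_sum_list[OF q] using \<open>w = 0\<close> w_def by simp
  finally show ?thesis using True by simp
next
  note q0 = distsD(1)[OF q] and fin = distsD(3)[OF q]
  case False
  then have T: "0 < T" unfolding T_def using q0 by (simp add: less_le sum_nonneg)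
  \<comment> \<open>\<open>b\<close> is the target without its factor 3. It will bound the tail mass
    \<open>w2\<close>, and \<open>b\<^sup>2 * real m\<close> the variance of one truncated
    letter.\<close>
  define b where "b = real m powr - u * T powr (1 - u)"
  define \<tau> where "\<tau> = (T * real m) powr (1 - u)"
  define g1 where "g1 = (\<lambda>x. if g x \<le> \<tau> then g x else 0)"
  define g2 where "g2 = (\<lambda>x. if g x \<le> \<tau> then 0 else g x)"
  define w1 where "w1 = (\<Sum>x\<in>A. q x * g1 x)"
  define w2 where "w2 = (\<Sum>x\<in>A. q x * g2 x)"
  define h where "h = (\<lambda>x. g1 x - w1)"
  have b: "0 < b" using T m by (simp add: b_def)
  have \<tau>: "0 < \<tau>" using T m by (simp add: \<tau>_def)
  have gsplit: "g x = g1 x + g2 x" for x by (simp add: g1_def g2_def)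
  have w: "w = w1 + w2"
    by (simp add: w_def w1_def w2_def gsplit distrib_left sum.distrib)
  have w2_nonneg: "0 \<le> w2" unfolding w2_def by (auto intro!: sum_nonneg simp: q0 g2_def g)
  have "w2 \<le> (\<Sum>x\<in>A. (T * real m) powr (- u) * (q x * g x powr (1 / (1 - u))))"
    unfolding w2_def
  proof (rule sum_mono)
    fix x assume x: "x \<in> A"
    \<comment> \<open>Above the threshold, the surplus factor \<open>g x powr (u / (1 - u))\<close>
      is at least \<open>(T * real m) powr u\<close>.\<close>
    have "g2 x \<le> (T * real m) powr (- u) * g x powr (1 / (1 - u))"
    proof (cases "g x \<le> \<tau>")
      case True
      then show ?thesis by (simp add: g2_def)
    next
      case False
      have "(T * real m) powr u = \<tau> powr (u / (1 - u))"
        using u by (simp add: \<tau>_def powr_powr)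
      also have "\<dots> \<le> g x powr (u / (1 - u))"
        using False u \<tau> by (intro powr_mono2) auto
      finally have "g x * (T * real m) powr u \<le> g x * g x powr (u / (1 - u))"
        using g[OF x] by (rule mult_left_mono)
      also have "\<dots> = g x powr (1 + u / (1 - u))"
        using False \<tau> by (simp add: powr_add)
      also have "1 + u / (1 - u) = 1 / (1 - u)"
        using u by (simp add: field_simps)
      finally show ?thesis
        using False T m by (simp add: g2_def powr_minus field_simps)
    qed
    then show "q x * g2 x \<le> (T * real m) powr (- u) * (q x * g x powr (1 / (1 - u)))"
      using mult_left_mono[OF _ q0[OF x]] by (metis mult.left_commute)
  qed
  also have "\<dots> = (T * real m) powr (- u) * T" by (simp add: T_def sum_distrib_left)
  also have "\<dots> = b"
    using T m by (simp add: b_def powr_mult powr_diff powr_minus field_simps)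
  finally have w2: "w2 \<le> b" .
  have "(\<Sum>x\<in>A. q x * (h x)\<^sup>2) = (\<Sum>x\<in>A. q x * (g1 x)\<^sup>2) - w1\<^sup>2"
  proof -
    have "(\<Sum>x\<in>A. q x * (h x)\<^sup>2) = (\<Sum>x\<in>A. q x * (g1 x)\<^sup>2 + w1\<^sup>2 * q x - 2 * w1 * (q x * g1 x))"
      by (simp add: h_def power2_diff algebra_simps)
    also have "\<dots> = (\<Sum>x\<in>A. q x * (g1 x)\<^sup>2) + w1\<^sup>2 * sum q A - 2 * w1 * w1"
      by (simp add: sum.distrib sum_subtractf sum_distrib_left[symmetric] w1_def)
    finally show ?thesis using distsD(2)[OF q] by (simp add: power2_eq_square)
  qed
  also have "\<dots> \<le> (\<Sum>x\<in>A. q x * (g1 x)\<^sup>2)" by simp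
  also have "\<dots> \<le> (\<Sum>x\<in>A. (T * real m) powr (1 - 2 * u) * (q x * g x powr (1 / (1 - u))))"
  proof (rule sum_mono)
    fix x assume x: "x \<in> A"
    \<comment> \<open>Below the threshold the square splits into the power
      \<open>1 / (1 - u)\<close> counted by \<open>T\<close> and the power
      \<open>(1 - 2 * u) / (1 - u)\<close>. The latter exponent is nonnegative since
      \<open>u <= 1/2\<close>, so \<open>\<tau>\<close> may replace \<open>g x\<close>
      there.\<close>
    have "(g1 x)\<^sup>2 \<le> (T * real m) powr (1 - 2 * u) * g x powr (1 / (1 - u))"
    proof (cases "0 < g x \<and> g x \<le> \<tau>")
      case True
      have "(g1 x)\<^sup>2 = g x powr 2" using True by (simp add: g1_def)
      also have "2 = (1 - 2 * u) / (1 - u) + 1 / (1 - u)" using u by (simp add: field_simps)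
      also have "g x powr \<dots> = g x powr ((1 - 2 * u) / (1 - u)) * g x powr (1 / (1 - u))"
        by (rule powr_add)
      also have "\<dots> \<le> \<tau> powr ((1 - 2 * u) / (1 - u)) * g x powr (1 / (1 - u))"
        using True u by (intro mult_right_mono powr_mono2) auto
      also have "\<tau> powr ((1 - 2 * u) / (1 - u)) = (T * real m) powr (1 - 2 * u)"
        using u by (simp add: \<tau>_def powr_powr)
      finally show ?thesis .
    next
      case False
      then have "g1 x = 0" using g[OF x] by (auto simp: g1_def)
      then show ?thesis by simp
    qed
    then show "q x * (g1 x)\<^sup>2 \<le> (T * real m) powr (1 - 2 * u) * (q x * g x powr (1 / (1 - u)))"
      using mult_left_mono[OF _ q0[OF x]] by (metis mult.left_commute)
  qed
  also have "\<dots> = (T * real m) powr (1 - 2 * u) * T" by (simp add: T_def sum_distrib_left)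
  also have "\<dots> = b\<^sup>2 * real m"
  proof -
    have "real m powr (1 - 2 * u) = real m powr (- u) * real m powr (- u) * real m"
      using m by (simp add: powr_add[symmetric] powr_mult_base mult.commute)
    moreover have "T powr (1 - 2 * u) * T = T powr (1 - u) * T powr (1 - u)"
      using T by (simp add: powr_add[symmetric] powr_mult_base mult.commute)
    ultimately show ?thesis
      using T m by (simp add: b_def powr_mult power2_eq_square mult_ac)
  qed
  finally have h2: "(\<Sum>x\<in>A. q x * (h x)\<^sup>2) \<le> b\<^sup>2 * real m" .
  have h0: "(\<Sum>x\<in>A. q x * h x) = 0"
    using distsD(2)[OF q]
    by (simp add: h_def right_diff_distrib sum_subtractf sum_distrib_right[symmetric] w1_def)
  \<comment> \<open>The bound \<open>|H| <= H^2 / (2 b) + b / 2\<close> replaces Cauchy-Schwarz and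
    keeps the integrand quadratic. After averaging, the square gives at most \<open>b / 2\<close>,
    and the tail enters twice: through its code average and through its mean.\<close>
  have "code_expectation A q m (\<lambda>xs. \<bar>(\<Sum>x\<leftarrow>xs. g x) / real m - w\<bar>)
      \<le> code_expectation A q m (\<lambda>xs. (1 / (2 * b * (real m)\<^sup>2)) * (\<Sum>x\<leftarrow>xs. h x)\<^sup>2
          + ((1 / real m) * (\<Sum>x\<leftarrow>xs. g2 x) + (b / 2 + w2)))"
  proof (rule code_expectation_mono[OF q])
    fix xs assume len: "length xs = m" and xs: "set xs \<subseteq> A"
    define H where "H = (\<Sum>x\<leftarrow>xs. h x) / real m"
    have g2: "0 \<le> (\<Sum>x\<leftarrow>xs. g2 x)"
      using xs by (intro sum_list_nonneg) (auto simp: g2_def intro: g)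
    have "(\<Sum>x\<leftarrow>xs. g x) = (\<Sum>x\<leftarrow>xs. h x) + (\<Sum>x\<leftarrow>xs. g2 x) + real (length xs) * w1"
      by (induction xs) (auto simp: h_def gsplit algebra_simps)
    then have "(\<Sum>x\<leftarrow>xs. g x) / real m - w = H + (\<Sum>x\<leftarrow>xs. g2 x) / real m - w2"
      using m by (simp add: len w H_def field_simps)
    then have "\<bar>(\<Sum>x\<leftarrow>xs. g x) / real m - w\<bar> \<le> \<bar>H\<bar> + (\<Sum>x\<leftarrow>xs. g2 x) / real m + w2"
      using divide_nonneg_nonneg[OF g2, of "real m"] w2_nonneg by linarith
    moreover have "\<bar>H\<bar> \<le> H\<^sup>2 / (2 * b) + b / 2"
    proof -
      have "0 \<le> (\<bar>H\<bar> - b)\<^sup>2" by simp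
      then have "2 * b * \<bar>H\<bar> \<le> H\<^sup>2 + b\<^sup>2" by (simp add: power2_diff mult_ac)
      then show ?thesis using b by (simp add: field_simps power2_eq_square)
    qed
    moreover have "H\<^sup>2 / (2 * b) = (1 / (2 * b * (real m)\<^sup>2)) * (\<Sum>x\<leftarrow>xs. h x)\<^sup>2"
      by (simp add: H_def power_divide)
    ultimately show "\<bar>(\<Sum>x\<leftarrow>xs. g x) / real m - w\<bar>
        \<le> (1 / (2 * b * (real m)\<^sup>2)) * (\<Sum>x\<leftarrow>xs. h x)\<^sup>2
          + ((1 / real m) * (\<Sum>x\<leftarrow>xs. g2 x) + (b / 2 + w2))"
      by simp
  qed
  also have "\<dots> = (\<Sum>x\<in>A. q x * (h x)\<^sup>2) / (2 * b * real m) + b / 2 + 2 * w2"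
    unfolding code_expectation_add code_expectation_cmult code_expectation_const[OF q]
      code_expectation_sum_list[OF q] code_expectation_square_centered[OF q h0]
    using m by (simp add: w2_def power2_eq_square)
  also have "\<dots> \<le> (b\<^sup>2 * real m) / (2 * b * real m) + b / 2 + 2 * b"
    using h2 w2 b m by (intro add_mono divide_right_mono) auto
  also have "\<dots> = 3 * b" using b m by (simp add: power2_eq_square)
  finally show ?thesis by (simp add: b_def)
qed

section \<open>Jensen bounds and the relative entropy of a random code\<close>

lemma jensen_shifted:
  assumes q: "q \<in> dists A" and g: "\<And>x. x \<in> A \<Longrightarrow> 0 \<le> g x"
    and L: "concave_on {0..} L" and c: "0 \<le> (c::real)"
  shows "(\<Sum>x\<in>A. q x * L (g x + c)) \<le> L ((\<Sum>x\<in>A. q x * g x) + c)"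
proof -
  have "(\<Sum>x\<in>A. q x * L (g x + c)) \<le> L (\<Sum>x\<in>A. q x *\<^sub>R (g x + c))"
    using distsD[OF q] g c by (intro concave_on_sum[OF _ _ L]) auto
  also have "(\<Sum>x\<in>A. q x *\<^sub>R (g x + c)) = (\<Sum>x\<in>A. q x * g x) + c"
    using distsD(2)[OF q] by (simp add: distrib_left sum.distrib sum_distrib_right[symmetric])
  finally show ?thesis .
qed

text \<open>Jensen replaces one letter at a time by its mean; the shift \<open>c\<close> carries the
  letters already fixed, so the induction generalises it.\<close>

lemma code_expectation_concave_le:
  assumes q: "q \<in> dists A" and g: "\<And>x. x \<in> A \<Longrightarrow> 0 \<le> g x"
    and L: "concave_on {0..} L" and c: "0 \<le> (c::real)"
  shows "code_expectation A q m (\<lambda>xs. L ((\<Sum>x\<leftarrow>xs. g x) + c)) \<le> L (real m * (\<Sum>x\<in>A. q x * g x) + c)"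
  using c
proof (induction m arbitrary: c)
  case (Suc m)
  define w where "w = (\<Sum>x\<in>A. q x * g x)"
  have w: "0 \<le> w" unfolding w_def by (auto intro!: sum_nonneg simp: g distsD(1)[OF q])
  have "code_expectation A q (Suc m) (\<lambda>xs. L ((\<Sum>x\<leftarrow>xs. g x) + c))
      = (\<Sum>x\<in>A. q x * code_expectation A q m (\<lambda>xs. L ((\<Sum>x\<leftarrow>xs. g x) + (g x + c))))"
    by (simp add: add_ac)
  also have "\<dots> \<le> (\<Sum>x\<in>A. q x * L (g x + (real m * w + c)))"
  proof (intro sum_mono mult_left_mono)
    fix x assume x: "x \<in> A"
    then have "0 \<le> g x + c" using g Suc.prems by simp
    from Suc.IH[OF this]
    show "code_expectation A q m (\<lambda>xs. L ((\<Sum>x\<leftarrow>xs. g x) + (g x + c))) \<le> L (g x + (real m * w + c))"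
      by (simp add: w_def add_ac)
  qed (rule distsD(1)[OF q])
  also have "\<dots> \<le> L (w + (real m * w + c))"
    unfolding w_def
    by (rule jensen_shifted[OF q g L]) (use w Suc.prems in \<open>auto simp: w_def\<close>)
  finally show ?case by (simp add: w_def algebra_simps)
qed simp

text \<open>Each of the \<open>m\<close> summands singles out one codeword, and the other
  \<open>m - 1\<close> enter \<open>L\<close> through their mean \<open>w\<close> by Jensen. The
  induction separates the first codeword from the rest.\<close>

lemma code_expectation_mult_concave_le:
  assumes q: "q \<in> dists A" and g: "\<And>x. x \<in> A \<Longrightarrow> 0 \<le> g x"
    and L: "concave_on {0..} L" and c: "0 \<le> (c::real)"
    and w_def: "w = (\<Sum>x\<in>A. q x * g x)"
  shows "code_expectation A q m (\<lambda>xs. (\<Sum>x\<leftarrow>xs. g x) * L ((\<Sum>x\<leftarrow>xs. g x) + c))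
    \<le> real m * (\<Sum>x\<in>A. q x * (g x * L (g x + (c + (real m - 1) * w))))"
  using c
proof (induction m arbitrary: c)
  case (Suc m)
  note q0 = distsD(1)[OF q]
  have w: "0 \<le> w" unfolding w_def by (auto intro!: sum_nonneg simp: g q0)
  define B where "B = (\<Sum>x\<in>A. q x * (g x * L (g x + (c + real m * w))))"
  have "code_expectation A q (Suc m) (\<lambda>xs. (\<Sum>x\<leftarrow>xs. g x) * L ((\<Sum>x\<leftarrow>xs. g x) + c))
      = (\<Sum>x\<in>A. q x * code_expectation A q m (\<lambda>xs. g x * L ((\<Sum>x\<leftarrow>xs. g x) + (g x + c))
          + (\<Sum>x\<leftarrow>xs. g x) * L ((\<Sum>x\<leftarrow>xs. g x) + (g x + c))))"
    by (simp add: algebra_simps)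
  also have "\<dots> = (\<Sum>x\<in>A. q x * (g x * code_expectation A q m (\<lambda>xs. L ((\<Sum>x\<leftarrow>xs. g x) + (g x + c)))))
      + (\<Sum>x\<in>A. q x * code_expectation A q m (\<lambda>xs. (\<Sum>x\<leftarrow>xs. g x) * L ((\<Sum>x\<leftarrow>xs. g x) + (g x + c))))"
    by (simp only: code_expectation_add code_expectation_cmult distrib_left sum.distrib)
  also have "\<dots> \<le> B + real m * B"
  proof (rule add_mono)
    show "(\<Sum>x\<in>A. q x * (g x * code_expectation A q m (\<lambda>xs. L ((\<Sum>x\<leftarrow>xs. g x) + (g x + c))))) \<le> B"
      unfolding B_def
    proof (intro sum_mono mult_left_mono)
      fix x assume x: "x \<in> A"
      then have "0 \<le> g x + c" using g Suc.prems by simp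
      from code_expectation_concave_le[OF q g L this, where m = m]
      show "code_expectation A q m (\<lambda>xs. L ((\<Sum>x\<leftarrow>xs. g x) + (g x + c))) \<le> L (g x + (c + real m * w))"
        by (simp add: w_def add_ac)
    qed (auto intro: q0 g)
    show "(\<Sum>x\<in>A. q x * code_expectation A q m
        (\<lambda>xs. (\<Sum>x\<leftarrow>xs. g x) * L ((\<Sum>x\<leftarrow>xs. g x) + (g x + c)))) \<le> real m * B"
    \<comment> \<open>For \<open>m = 0\<close> the sum is empty; otherwise the shift
      \<open>(real m - 1) * w\<close> is nonnegative, as Jensen on \<open>{0..}\<close>
      requires.\<close>
    proof (cases "m = 0")
      case False
      then have m: "0 \<le> (real m - 1) * w" using w by simp
      have "(\<Sum>x\<in>A. q x * code_expectation A q m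
            (\<lambda>xs. (\<Sum>x\<leftarrow>xs. g x) * L ((\<Sum>x\<leftarrow>xs. g x) + (g x + c))))
          \<le> (\<Sum>x\<in>A. q x * (real m * (\<Sum>x'\<in>A. q x' * (g x' * L (g x' + ((g x + c) + (real m - 1) * w))))))"
        by (intro sum_mono mult_left_mono Suc.IH) (auto intro: q0 add_nonneg_nonneg g Suc.prems)
      \<comment> \<open>With the singled-out codeword \<open>x'\<close> outermost, the first
        codeword \<open>x\<close> occurs only inside \<open>L\<close> and can be averaged by
        Jensen.\<close>
      also have "\<dots> = real m * (\<Sum>x'\<in>A. q x' * (g x' * (\<Sum>x\<in>A. q x * L (g x + (g x' + c + (real m - 1) * w)))))"
        unfolding sum_distrib_left
        by (subst sum.swap) (simp add: algebra_simps)
      also have "\<dots> \<le> real m * (\<Sum>x'\<in>A. q x' * (g x' * L (w + (g x' + c + (real m - 1) * w))))"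
        unfolding w_def
        by (intro mult_left_mono sum_mono jensen_shifted[OF q g L])
          (use m Suc.prems in \<open>auto simp: w_def[symmetric] intro!: q0 g add_nonneg_nonneg\<close>)
      also have "\<dots> = real m * B" by (simp add: B_def algebra_simps)
      finally show ?thesis .
    qed simp
  qed
  also have "\<dots> = real (Suc m) * B" by (simp add: algebra_simps)
  finally show ?case by (simp add: B_def)
qed simp

text \<open>Adding one \<open>w\<close> inside the logarithm completes the \<open>m - 1\<close>
  averaged codewords to \<open>real m * w\<close>, which produces
  \<open>ln (1 + g x / (real m * w))\<close>. No second moment enters, so every \<open>u\<close>
  below 1 is allowed.\<close>

lemma code_expectation_relative_entropy_le:
  assumes q: "q \<in> dists A" and g: "\<And>x. x \<in> A \<Longrightarrow> 0 \<le> g x"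
    and m: "0 < m" and u: "0 < u" "u < 1"
    and T_def: "T = (\<Sum>x\<in>A. q x * g x powr (1 / (1 - u)))"
    and w_def: "w = (\<Sum>x\<in>A. q x * g x)"
  shows "code_expectation A q m
      (\<lambda>xs. (\<Sum>x\<leftarrow>xs. g x) / real m * ln ((\<Sum>x\<leftarrow>xs. g x) / real m / w))
    \<le> real m powr - u * T powr (1 - u) / u"
proof (cases "w = 0")
  case True
  \<comment> \<open>Division by 0 and \<open>ln 0\<close> both give 0, so the left side
    vanishes.\<close>
  then show ?thesis using u by (simp add: code_expectation_const[OF q])
next
  note q0 = distsD(1)[OF q] and fin = distsD(3)[OF q]
  case False
  then have w: "0 < w" unfolding w_def using q0 g by (simp add: less_le sum_nonneg)
  \<comment> \<open>The summand \<open>w\<close> keeps the argument of the logarithm positive down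
    to \<open>v = 0\<close> and only enlarges the logarithm.\<close>
  define L where "L = (\<lambda>v. ln ((v + w) / (real m * w)))"
  have L: "concave_on {0..} L"
    unfolding concave_on_iff
  proof (intro conjI ballI allI impI)
    fix x y a b :: real
    assume *: "x \<in> {0..}" "y \<in> {0..}" "0 \<le> a" "0 \<le> b" "a + b = 1"
    have L: "L v = ln (v + w) - ln (real m * w)" if "0 \<le> v" for v
      using that w m by (simp add: L_def ln_div)
    have "a * L x + b * L y = a * ln (x + w) + b * ln (y + w) - (a + b) * ln (real m * w)"
      using *(1,2) by (simp add: L algebra_simps)
    also have "a * ln (x + w) + b * ln (y + w) \<le> ln (a *\<^sub>R (x + w) + b *\<^sub>R (y + w))"
      using ln_concave * w unfolding concave_on_iff by (auto simp: add_nonneg_pos)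
    also have "a *\<^sub>R (x + w) + b *\<^sub>R (y + w) = a *\<^sub>R x + b *\<^sub>R y + (a + b) * w"
      by (simp add: algebra_simps)
    finally show "a * L x + b * L y \<le> L (a *\<^sub>R x + b *\<^sub>R y)"
      using * by (simp add: L)
  qed simp
  have "code_expectation A q m
      (\<lambda>xs. (\<Sum>x\<leftarrow>xs. g x) / real m * ln ((\<Sum>x\<leftarrow>xs. g x) / real m / w))
    \<le> code_expectation A q m (\<lambda>xs. (1 / real m) * ((\<Sum>x\<leftarrow>xs. g x) * L ((\<Sum>x\<leftarrow>xs. g x) + 0)))"
  proof (rule code_expectation_mono[OF q])
    fix xs assume xs: "set xs \<subseteq> A"
    define S where "S = (\<Sum>x\<leftarrow>xs. g x)"
    have "0 \<le> S" using xs unfolding S_def by (intro sum_list_nonneg) (auto intro: g)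
    have "S * ln (S / real m / w) \<le> S * L S"
    proof (cases "S = 0")
      case False
      then show ?thesis
        using \<open>0 \<le> S\<close> w m unfolding L_def
        by (intro mult_left_mono, subst ln_le_cancel_iff) (auto simp: field_simps)
    qed simp
    then show "S / real m * ln (S / real m / w) \<le> (1 / real m) * (S * L (S + 0))"
      using m by (simp add: field_simps)
  qed
  also have "\<dots> \<le> (1 / real m) * (real m * (\<Sum>x\<in>A. q x * (g x * L (g x + (0 + (real m - 1) * w)))))"
    unfolding code_expectation_cmult
    by (intro mult_left_mono code_expectation_mult_concave_le[OF q g L] w_def) auto
  also have "\<dots> = (\<Sum>x\<in>A. q x * (g x * ln (1 + g x / (real m * w))))"
    using m w by (simp add: L_def field_simps)
  also have "\<dots> \<le> (\<Sum>x\<in>A. q x * (g x * ((g x / (real m * w)) powr u / u)))"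
    using u w by (intro sum_mono mult_left_mono ln_one_plus_le_powr)
      (auto intro!: q0 g divide_nonneg_nonneg)
  \<comment> \<open>The terms are arranged for Hoelder: one factor sums to \<open>T\<close>, the
    other to \<open>w\<close>, whose power cancels against
    \<open>(real m * w) powr - u\<close>.\<close>
  also have "\<dots> = (\<Sum>x\<in>A. (q x * g x powr (1 / (1 - u))) powr (1 - u) * (q x * g x) powr u)
      * (real m * w) powr - u / u"
    unfolding sum_distrib_right sum_divide_distrib
  proof (rule sum.cong[OF refl])
    fix x assume x: "x \<in> A"
    show "q x * (g x * ((g x / (real m * w)) powr u / u)) =
      (q x * g x powr (1 / (1 - u))) powr (1 - u) * (q x * g x) powr u * (real m * w) powr - u / u"
    proof (cases "q x = 0 \<or> g x = 0")
      case False
      then have pos: "0 < q x" "0 < g x" using q0 g x by (auto simp: less_le)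
      have "q x powr (1 - u) * q x powr u = q x"
        using pos by (simp add: powr_add[symmetric])
      moreover have "(g x powr (1 / (1 - u))) powr (1 - u) = g x"
        using pos u by (simp add: powr_powr)
      ultimately show ?thesis
        using pos w m by (simp add: powr_mult powr_divide powr_minus field_simps)
    qed auto
  qed
  also have "\<dots> \<le> (T powr (1 - u) * w powr u) * (real m * w) powr - u / u"
    unfolding T_def w_def
    using u by (intro divide_right_mono mult_right_mono holder_powr[OF fin]) (auto intro!: mult_nonneg_nonneg q0 g)
  also have "\<dots> = real m powr - u * T powr (1 - u) / u"
    using w m by (simp add: powr_mult powr_minus field_simps)
  finally show ?thesis .
qed

section \<open>One-shot bounds\<close>

text \<open>For \<open>t = - u\<close> this is \<open>exp (phi t V q)\<close>.\<close>

definition gallager ::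
    "'a set \<Rightarrow> 'b set \<Rightarrow> ('a \<Rightarrow> 'b \<Rightarrow> real) \<Rightarrow> ('a \<Rightarrow> real) \<Rightarrow> real \<Rightarrow> real" where
  "gallager A B V q u = (\<Sum>y\<in>B. (\<Sum>x\<in>A. q x * V x y powr (1 / (1 - u))) powr (1 - u))"

text \<open>The average over codes commutes with the sum over outputs, so one code serves all
  outputs at once.\<close>

lemma exists_code_eps_le:
  assumes q: "q \<in> dists A" and V: "\<And>x y. x \<in> A \<Longrightarrow> y \<in> B \<Longrightarrow> 0 \<le> V x y"
    and m: "0 < m" and u: "0 \<le> u" "u \<le> 1/2"
  shows "\<exists>\<Psi>. length \<Psi> = m \<and> set \<Psi> \<subseteq> A \<and>
    eps_code B V \<Psi> (outdist A V q) \<le> 3 * (real m powr - u * gallager A B V q u)"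
proof -
  define f where "f = (\<lambda>\<Psi>. \<Sum>y\<in>B. \<bar>(\<Sum>x\<leftarrow>\<Psi>. V x y) / real m - outdist A V q y\<bar>)"
  have "code_expectation A q m f
      \<le> (\<Sum>y\<in>B. 3 * (real m powr - u * (\<Sum>x\<in>A. q x * V x y powr (1 / (1 - u))) powr (1 - u)))"
    unfolding f_def code_expectation_sum
    by (intro sum_mono code_expectation_abs_deviation_le[OF q _ m u refl])
      (auto simp: outdist_def V)
  also have "\<dots> = 3 * (real m powr - u * gallager A B V q u)"
    by (simp add: gallager_def sum_distrib_left)
  finally obtain \<Psi> where \<Psi>: "length \<Psi> = m" "set \<Psi> \<subseteq> {x \<in> A. 0 < q x}"
      "f \<Psi> \<le> 3 * (real m powr - u * gallager A B V q u)"
    using exists_code_le_expectation[OF q, of m f] by force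
  moreover have "f \<Psi> = eps_code B V \<Psi> (outdist A V q)"
    by (simp add: f_def eps_code_def code_avg_def \<Psi>(1))
  ultimately show ?thesis by (intro exI[of _ \<Psi>]) auto
qed

lemma exists_code_D_le:
  assumes q: "q \<in> dists A" and V: "\<And>x y. x \<in> A \<Longrightarrow> y \<in> B \<Longrightarrow> 0 \<le> V x y"
    and m: "0 < m" and u: "0 < u" "u < 1"
  shows "\<exists>\<Psi>. length \<Psi> = m \<and> set \<Psi> \<subseteq> A \<and>
    D_code B V \<Psi> (outdist A V q) \<le> ereal (real m powr - u * gallager A B V q u / u)"
proof -
  define f where "f = (\<lambda>\<Psi>. \<Sum>y\<in>B. (\<Sum>x\<leftarrow>\<Psi>. V x y) / real m
    * ln ((\<Sum>x\<leftarrow>\<Psi>. V x y) / real m / outdist A V q y))"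
  have "code_expectation A q m f
      \<le> (\<Sum>y\<in>B. real m powr - u * (\<Sum>x\<in>A. q x * V x y powr (1 / (1 - u))) powr (1 - u) / u)"
    unfolding f_def code_expectation_sum
    by (intro sum_mono code_expectation_relative_entropy_le[OF q _ m u refl])
      (auto simp: outdist_def V)
  also have "\<dots> = real m powr - u * gallager A B V q u / u"
    by (simp add: gallager_def sum_distrib_left sum_divide_distrib)
  finally obtain \<Psi> where \<Psi>: "length \<Psi> = m" "set \<Psi> \<subseteq> {x \<in> A. 0 < q x}"
      "f \<Psi> \<le> real m powr - u * gallager A B V q u / u"
    using exists_code_le_expectation[OF q, of m f] by force
  \<comment> \<open>Codewords come from the support of \<open>q\<close>, so every output reached by
    the code has positive probability and \<open>KL\<close> is in its finite branch.\<close>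
  have "outdist A V q y \<noteq> 0" if y: "y \<in> B" and pos: "0 < code_avg V \<Psi> y" for y
  proof -
    have "\<exists>x\<in>set \<Psi>. V x y \<noteq> 0"
    proof (rule ccontr)
      assume "\<not> ?thesis"
      then have "map (\<lambda>x. V x y) \<Psi> = map (\<lambda>_. 0) \<Psi>" by simp
      then have "(\<Sum>x\<leftarrow>\<Psi>. V x y) = 0" by (simp only: sum_list_0)
      then show False using pos by (simp add: code_avg_def)
    qed
    then obtain x where x: "x \<in> A" "0 < q x" "V x y \<noteq> 0" using \<Psi>(2) by auto
    have "0 < q x * V x y" using x V[OF x(1) y] by simp
    also have "\<dots> \<le> outdist A V q y"
      unfolding outdist_def using x distsD[OF q] V y
      by (intro member_le_sum) auto
    finally show ?thesis by simp
  qed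
  then have "D_code B V \<Psi> (outdist A V q) = ereal (f \<Psi>)"
    by (auto simp: D_code_def KL_def f_def code_avg_def \<Psi>(1) intro!: sum.cong)
  then show ?thesis using \<Psi> by (intro exI[of _ \<Psi>]) auto
qed

text \<open>The inequality \<open>ln z <= z - 1\<close> gives \<open>a ln (a / b) >= a - b\<close>
  termwise, and the right sides sum to 0. The exponents need this sign because \<open>rate\<close>
  takes a logarithm.\<close>

lemma KL_nonneg:
  assumes "\<And>y. y \<in> B \<Longrightarrow> 0 \<le> a y" "\<And>y. y \<in> B \<Longrightarrow> 0 \<le> b y" "sum a B = 1" "sum b B = 1"
  shows "0 \<le> KL B a b"
proof (cases "\<exists>y\<in>B. 0 < a y \<and> b y = 0")
  case False
  have "0 = (\<Sum>y\<in>B. a y - b y)" using assms by (simp add: sum_subtractf)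
  also have "\<dots> \<le> (\<Sum>y\<in>B. if a y = 0 then 0 else a y * ln (a y / b y))"
  proof (rule sum_mono)
    fix y assume y: "y \<in> B"
    show "a y - b y \<le> (if a y = 0 then 0 else a y * ln (a y / b y))"
    proof (cases "a y = 0")
      case True
      then show ?thesis using assms y by simp
    next
      case a: False
      have pos: "0 < a y" "0 < b y" using a y assms(1,2) False by (force simp: less_le)+
      have "ln (b y / a y) \<le> b y / a y - 1" using pos by (intro ln_le_minus_one) auto
      then have "1 - b y / a y \<le> ln (a y / b y)" using pos by (simp add: ln_div)
      then have "a y * (1 - b y / a y) \<le> a y * ln (a y / b y)"
        using pos by (intro mult_left_mono) auto
      then show ?thesis using pos by (simp add: right_diff_distrib)
    qed
  qed
  finally show ?thesis using False by (simp add: KL_def)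
qed (simp add: KL_def)

lemma D_code_nonneg:
  assumes q: "q \<in> dists A" and V: "\<And>x y. x \<in> A \<Longrightarrow> y \<in> B \<Longrightarrow> 0 \<le> V x y"
    and V1: "\<And>x. x \<in> A \<Longrightarrow> (\<Sum>y\<in>B. V x y) = 1"
    and \<Psi>: "\<Psi> \<noteq> []" "set \<Psi> \<subseteq> A"
  shows "0 \<le> D_code B V \<Psi> (outdist A V q)"
  unfolding D_code_def
proof (rule KL_nonneg)
  fix y assume "y \<in> B"
  then show "0 \<le> code_avg V \<Psi> y" "0 \<le> outdist A V q y"
    using \<Psi> V distsD(1)[OF q]
    by (auto simp: code_avg_def outdist_def subset_iff
        intro!: divide_nonneg_nonneg sum_list_nonneg sum_nonneg)
next
  have "(\<Sum>y\<in>B. \<Sum>x\<leftarrow>\<Psi>. V x y) = real (length \<Psi>)"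
    using \<Psi>(2) by (induction \<Psi>) (auto simp: sum.distrib V1)
  then show "sum (code_avg V \<Psi>) B = 1"
    using \<Psi>(1) by (simp add: code_avg_def sum_divide_distrib[symmetric])
  have "sum (outdist A V q) B = (\<Sum>x\<in>A. q x * (\<Sum>y\<in>B. V x y))"
    unfolding outdist_def sum_distrib_left by (rule sum.swap)
  then show "sum (outdist A V q) B = 1" using distsD(2)[OF q] V1 by simp
qed

section \<open>Memoryless extensions\<close>

lemma channelD:
  assumes "channel W"
  shows "0 \<le> W x y" "(\<Sum>y\<in>UNIV. W x y) = 1"
  using assms by (auto simp: channel_def)

lemma channel_le_one:
  assumes "channel W"
  shows "W x y \<le> 1"
  using channelD[OF assms] member_le_sum[of y UNIV "W x"] by simp

lemma seqs_0: "seqs 0 = {[]}"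
  by (auto simp: seqs_def)

lemma sum_seqs_Suc:
  fixes f :: "'a::finite list \<Rightarrow> 'b::comm_monoid_add"
  shows "(\<Sum>xs\<in>seqs (Suc n). f xs) = (\<Sum>x\<in>UNIV. \<Sum>xs\<in>seqs n. f (x # xs))"
proof -
  have "seqs (Suc n) = (\<lambda>(x, xs). x # xs) ` (UNIV \<times> seqs n :: ('a \<times> 'a list) set)"
    by (auto simp: seqs_def length_Suc_conv image_iff)
  moreover have "inj_on (\<lambda>(x, xs). x # xs) (UNIV \<times> seqs n :: ('a \<times> 'a list) set)"
    by (auto simp: inj_on_def)
  ultimately have "(\<Sum>xs\<in>seqs (Suc n). f xs) = (\<Sum>(x, xs)\<in>UNIV \<times> seqs n. f (x # xs))"
    by (simp add: sum.reindex case_prod_unfold)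
  then show ?thesis by (simp add: sum.cartesian_product)
qed

lemma Wn_Nil: "Wn W [] ys = 1"
  by (simp add: Wn_def)

lemma Wn_Cons: "Wn W (x # xs) (y # ys) = W x y * Wn W xs ys"
  by (simp add: Wn_def prod.lessThan_Suc_shift del: prod.lessThan_Suc)

lemma pn_Nil: "pn p [] = 1"
  by (simp add: pn_def)

lemma pn_Cons: "pn p (x # xs) = p x * pn p xs"
  by (simp add: pn_def prod.lessThan_Suc_shift del: prod.lessThan_Suc)

lemma Wn_nonneg: "channel W \<Longrightarrow> 0 \<le> Wn W xs ys"
  by (simp add: Wn_def prod_nonneg channelD)

lemma sum_Wn:
  assumes "channel W" "xs \<in> seqs n"
  shows "(\<Sum>ys\<in>seqs n. Wn W xs ys) = 1"
  using assms(2)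
proof (induction n arbitrary: xs)
  case (Suc n)
  then obtain x xs' where xs: "xs = x # xs'" "xs' \<in> seqs n"
    by (auto simp: seqs_def length_Suc_conv)
  then show ?case
    using Suc.IH[OF xs(2)] channelD[OF assms(1)]
    by (simp add: sum_seqs_Suc Wn_Cons sum_distrib_left[symmetric])
qed (simp add: seqs_0 Wn_Nil)

lemma pn_in_dists:
  fixes p :: "'x::finite \<Rightarrow> real"
  assumes "p \<in> dists UNIV"
  shows "pn p \<in> dists (seqs n)"
proof -
  have "(\<Sum>xs\<in>seqs n. pn p xs) = 1"
    using distsD(2)[OF assms]
    by (induction n) (simp_all add: seqs_0 pn_Nil sum_seqs_Suc pn_Cons sum_distrib_left[symmetric])
  moreover have "0 \<le> pn p xs" for xs
    using distsD(1)[OF assms] by (auto simp: pn_def intro!: prod_nonneg)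
  ultimately show ?thesis by (simp add: dists_def)
qed

section \<open>Multiplicativity for product inputs, submultiplicativity for all inputs\<close>

lemma gallager_pn:
  fixes W :: "'x::finite \<Rightarrow> 'y::finite \<Rightarrow> real"
  assumes W: "channel W" and p: "p \<in> dists UNIV"
  shows "gallager (seqs n) (seqs n) (Wn W) (pn p) u = gallager UNIV UNIV W p u ^ n"
proof (induction n)
  case (Suc n)
  define G where "G = (\<lambda>y. \<Sum>x\<in>UNIV. p x * W x y powr (1 / (1 - u)))"
  define Gn where "Gn = (\<lambda>ys. \<Sum>xs\<in>seqs n. pn p xs * Wn W xs ys powr (1 / (1 - u)))"
  have nn: "0 \<le> G y" "0 \<le> Gn ys" for y ys
    using distsD(1)[OF p] distsD(1)[OF pn_in_dists[OF p]]
    by (auto simp: G_def Gn_def intro!: sum_nonneg)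
  have "(\<Sum>xs\<in>seqs (Suc n). pn p xs * Wn W xs (y # ys) powr (1 / (1 - u))) = G y * Gn ys" for y ys
    unfolding sum_seqs_Suc pn_Cons Wn_Cons G_def Gn_def sum_product
    by (simp add: powr_mult channelD[OF W] Wn_nonneg[OF W] mult_ac)
  then have "gallager (seqs (Suc n)) (seqs (Suc n)) (Wn W) (pn p) u
      = (\<Sum>y\<in>UNIV. \<Sum>ys\<in>seqs n. G y powr (1 - u) * Gn ys powr (1 - u))"
    \<comment> \<open>Only the outer sum over outputs is split at its first letter; the inner sum
      over inputs stays whole so that its factorisation applies.\<close>
    unfolding gallager_def sum_seqs_Suc[of "\<lambda>ys. _ ys powr _"] using nn by (simp add: powr_mult)
  also have "\<dots> = gallager UNIV UNIV W p u * gallager (seqs n) (seqs n) (Wn W) (pn p) u"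
    by (simp add: gallager_def G_def Gn_def sum_product)
  finally show ?case using Suc.IH by simp
qed (simp add: gallager_def seqs_0 Wn_Nil pn_Nil)

text \<open>The functional is homogeneous of degree \<open>1 - u\<close> in the input measure, so
  normalising a nonzero measure reduces the claim to \<open>bound\<close>.\<close>

lemma gallager_unnormalised_le:
  fixes W :: "'x::finite \<Rightarrow> 'y::finite \<Rightarrow> real"
  assumes bound: "\<And>q. q \<in> dists UNIV \<Longrightarrow> gallager UNIV UNIV W q u \<le> \<Phi>"
    and q: "\<And>x. 0 \<le> q x"
  shows "gallager UNIV UNIV W q u \<le> sum q UNIV powr (1 - u) * \<Phi>"
proof (cases "sum q UNIV = 0")
  case True
  then have "q x = 0" for x using q by (simp add: sum_nonneg_eq_0_iff)
  then show ?thesis by (simp add: gallager_def)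
next
  case False
  define c where "c = sum q UNIV"
  have c: "0 < c" using False q by (simp add: c_def less_le sum_nonneg)
  define r where "r = (\<lambda>x. q x / c)"
  have r: "r \<in> dists UNIV"
    using c q by (simp add: dists_def r_def sum_divide_distrib[symmetric]) (simp add: c_def)
  have qr: "q x = c * r x" for x using c by (simp add: r_def)
  have rn: "0 \<le> (\<Sum>x\<in>UNIV. r x * W x y powr (1 / (1 - u)))" for y
    using distsD(1)[OF r] by (auto intro!: sum_nonneg)
  have "gallager UNIV UNIV W q u
      = (\<Sum>y\<in>UNIV. (c * (\<Sum>x\<in>UNIV. r x * W x y powr (1 / (1 - u)))) powr (1 - u))"
    unfolding gallager_def by (simp add: qr sum_distrib_left mult.assoc)
  also have "\<dots> = c powr (1 - u) * gallager UNIV UNIV W r u"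
    using c rn by (simp add: gallager_def powr_mult flip: sum_distrib_left)
  also have "\<dots> \<le> c powr (1 - u) * \<Phi>" using bound[OF r] by (rule mult_left_mono) simp
  finally show ?thesis by (simp add: c_def)
qed

text \<open>Conditioning on the first output letter \<open>y\<close>, the remaining letters see the unnormalised
  input measure \<open>r y\<close>, so homogeneity of the bound makes it multiplicative without any
  optimality condition on the input distribution.\<close>

lemma gallager_Wn_unnormalised_le:
  fixes W :: "'x::finite \<Rightarrow> 'y::finite \<Rightarrow> real"
  assumes W: "channel W"
    and bound: "\<And>q. q \<in> dists UNIV \<Longrightarrow> gallager UNIV UNIV W q u \<le> \<Phi>" and \<Phi>: "0 \<le> \<Phi>"
    and q: "\<And>xs. xs \<in> seqs n \<Longrightarrow> 0 \<le> q xs"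
  shows "gallager (seqs n) (seqs n) (Wn W) q u \<le> sum q (seqs n) powr (1 - u) * \<Phi> ^ n"
  using q
proof (induction n arbitrary: q)
  case (Suc n)
  define r where "r = (\<lambda>y xs. \<Sum>x\<in>UNIV. q (x # xs) * W x y powr (1 / (1 - u)))"
  define q1 where "q1 = (\<lambda>x. \<Sum>xs\<in>seqs n. q (x # xs))"
  have qn: "0 \<le> q (x # xs)" if "xs \<in> seqs n" for x xs
    using Suc.prems that by (simp add: seqs_def)
  have r: "0 \<le> r y xs" if "xs \<in> seqs n" for y xs
    using qn[OF that] by (auto simp: r_def intro!: sum_nonneg)
  have q1: "0 \<le> q1 x" for x using qn by (auto simp: q1_def intro!: sum_nonneg)
  have "(\<Sum>xs\<in>seqs (Suc n). q xs * Wn W xs (y # ys) powr (1 / (1 - u)))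
      = (\<Sum>xs\<in>seqs n. r y xs * Wn W xs ys powr (1 / (1 - u)))" for y ys
    unfolding sum_seqs_Suc r_def sum_distrib_right
    by (subst sum.swap) (simp add: Wn_Cons powr_mult channelD[OF W] Wn_nonneg[OF W] mult_ac)
  then have "gallager (seqs (Suc n)) (seqs (Suc n)) (Wn W) q u
      = (\<Sum>y\<in>UNIV. gallager (seqs n) (seqs n) (Wn W) (r y) u)"
    unfolding gallager_def sum_seqs_Suc[of "\<lambda>ys. _ ys powr _"] by simp
  also have "\<dots> \<le> (\<Sum>y\<in>UNIV. sum (r y) (seqs n) powr (1 - u) * \<Phi> ^ n)"
    by (intro sum_mono Suc.IH r)
  \<comment> \<open>The mass of \<open>r y\<close> is the inner sum of the single-letter functional
    at the first-letter marginal \<open>q1\<close>, so summing over \<open>y\<close> rebuilds that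
    functional.\<close>
  also have "sum (r y) (seqs n) = (\<Sum>x\<in>UNIV. q1 x * W x y powr (1 / (1 - u)))" for y
    unfolding r_def q1_def sum_distrib_right by (rule sum.swap)
  then have "(\<Sum>y\<in>UNIV. sum (r y) (seqs n) powr (1 - u) * \<Phi> ^ n)
      = gallager UNIV UNIV W q1 u * \<Phi> ^ n"
    by (simp add: gallager_def sum_distrib_right)
  also have "\<dots> \<le> (sum q1 UNIV powr (1 - u) * \<Phi>) * \<Phi> ^ n"
    using \<Phi> by (intro mult_right_mono gallager_unnormalised_le bound q1) auto
  also have "sum q1 UNIV = sum q (seqs (Suc n))" by (simp add: q1_def sum_seqs_Suc)
  finally show ?case by (simp add: mult_ac)
qed (simp add: gallager_def seqs_0 Wn_Nil)

section \<open>Exponents\<close>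

text \<open>The prefactor contributes \<open>ln C / real n\<close>, which vanishes in the limit;
  where \<open>X n = 0\<close>, \<open>rate\<close> is infinite and the bound is trivial.\<close>

lemma liminf_rate_ge:
  assumes nonneg: "\<And>n. 0 \<le> X n" and le: "\<And>n. X n \<le> ereal (C * exp (- (real n * e)))"
    and C: "0 < C"
  shows "ereal e \<le> liminf (\<lambda>n. rate n (X n))"
proof -
  have "((\<lambda>n. e - ln C / real n) \<longlongrightarrow> e - 0) sequentially"
    by (intro tendsto_intros lim_const_over_n)
  then have "((\<lambda>n. ereal (e - ln C / real n)) \<longlongrightarrow> ereal e) sequentially"
    by (simp add: tendsto_ereal)
  then have "ereal e = liminf (\<lambda>n. ereal (e - ln C / real n))"
    by (intro lim_imp_Liminf[symmetric]) simp_all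
  also have "\<dots> \<le> liminf (\<lambda>n. rate n (X n))"
  proof (rule Liminf_mono, rule eventually_sequentiallyI[of 1])
    fix n :: nat assume n: "1 \<le> n"
    show "ereal (e - ln C / real n) \<le> rate n (X n)"
    proof (cases "X n = 0")
      case False
      then have "0 < X n" using nonneg[of n] by simp
      then obtain x where x: "X n = ereal x" "0 < x"
        using le[of n] by (cases "X n") auto
      then have "x \<le> C * exp (- (real n * e))" using le[of n] by simp
      then have "ln x \<le> ln (C * exp (- (real n * e)))"
        using x C by (subst ln_le_cancel_iff) auto
      also have "\<dots> = ln C - real n * e" using C by (simp add: ln_mult)
      finally have "(real n * e - ln C) / real n \<le> - ln x / real n"
        by (intro divide_right_mono) auto
      then have "e - ln C / real n \<le> - ln x / real n"
        using n by (simp add: diff_divide_distrib)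
      then show ?thesis using x by (simp add: rate_def)
    qed (simp add: rate_def)
  qed
  finally show ?thesis .
qed

definition num_codewords :: "real \<Rightarrow> nat \<Rightarrow> nat" where
  "num_codewords R n = nat \<lfloor>exp (real n * R)\<rfloor>"

lemma num_codewords_pos: "0 \<le> R \<Longrightarrow> 0 < num_codewords R n"
  by (simp add: num_codewords_def)

lemma num_codewords_le: "real (num_codewords R n) \<le> exp (real n * R)"
  by (simp add: num_codewords_def)

text \<open>Rounding down at most halves the size, because \<open>M >= 1\<close> and
  \<open>M + 1 > exp (real n * R)\<close>; the power \<open>u <= 1\<close> keeps this loss within a
  factor 2.\<close>

lemma num_codewords_powr_le:
  assumes R: "0 \<le> R" and u: "0 \<le> u" "u \<le> 1"
  shows "real (num_codewords R n) powr - u \<le> 2 * exp (- (real n * (u * R)))"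
proof -
  define M where "M = real (num_codewords R n)"
  have "1 \<le> M" using num_codewords_pos[OF R, of n] by (simp add: M_def)
  moreover have "exp (real n * R) < M + 1"
    using R unfolding M_def num_codewords_def by simp
  ultimately have "exp (real n * R) / 2 \<le> M" by linarith
  then have "M powr - u \<le> (exp (real n * R) / 2) powr - u"
    using u by (intro powr_mono2') auto
  also have "\<dots> = 2 powr u * exp (- (real n * (u * R)))"
    by (simp add: powr_divide powr_minus exp_minus exp_powr_real field_simps)
  also have "\<dots> \<le> 2 powr 1 * exp (- (real n * (u * R)))"
    using u by (intro mult_right_mono powr_mono) auto
  finally show ?thesis by (simp add: M_def)
qed

lemma code_bound_le_exp:
  assumes R: "0 \<le> R" and u: "0 \<le> u" "u \<le> 1" and g: "0 \<le> g" "g \<le> exp f ^ n"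
  shows "real (num_codewords R n) powr - u * g \<le> 2 * exp (- (real n * (u * R - f)))"
proof -
  have "real (num_codewords R n) powr - u * g \<le> (2 * exp (- (real n * (u * R)))) * exp f ^ n"
    using g by (intro mult_mono num_codewords_powr_le R u) auto
  also have "exp f ^ n = exp (real n * f)" by (simp add: exp_of_nat_mult)
  also have "(2 * exp (- (real n * (u * R)))) * exp (real n * f) = 2 * exp (- (real n * (u * R - f)))"
    by (simp add: mult_exp_exp algebra_simps)
  finally show ?thesis .
qed

lemma in_code_seqs:
  assumes R: "0 \<le> R" and \<Psi>: "\<And>n. length (\<Psi> n) = num_codewords R n" "\<And>n. set (\<Psi> n) \<subseteq> seqs n"
  shows "\<Psi> \<in> code_seqs R"
proof -
  have "\<Psi> n \<noteq> []" for n using \<Psi>(1)[of n] num_codewords_pos[OF R, of n] by auto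
  moreover have "ln (real (length (\<Psi> n))) / real n \<le> R" for n
  proof -
    have "ln (real (length (\<Psi> n))) \<le> ln (exp (real n * R))"
      unfolding \<Psi>(1) using num_codewords_pos[OF R, of n] num_codewords_le[of R n]
      by (subst ln_le_cancel_iff) auto
    \<comment> \<open>At \<open>n = 0\<close> the quotient is 0 by convention, which
      \<open>0 <= R\<close> covers.\<close>
    then show ?thesis using R by (cases "n = 0") (auto simp: field_simps)
  qed
  then have "limsup (\<lambda>n. ereal (ln (real (length (\<Psi> n))) / real n)) \<le> ereal R"
    by (intro Limsup_bounded always_eventually) auto
  ultimately show ?thesis using \<Psi>(2) by (simp add: code_seqs_def)
qed

section \<open>Lower bounds on the four exponents\<close>

lemma gallager_nonneg: "0 \<le> gallager A B V q u"
  by (simp add: gallager_def sum_nonneg)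

lemma eps_code_nonneg: "0 \<le> eps_code B V \<Psi> r"
  by (simp add: eps_code_def sum_nonneg)

text \<open>The parameter \<open>f\<close> stands for any logarithmic bound on the single-letter
  functional, so that the function of the theorem can be inserted later.\<close>

lemma e_eps_p_ge:
  fixes W :: "'x::finite \<Rightarrow> 'y::finite \<Rightarrow> real"
  assumes W: "channel W" and p: "p \<in> dists UNIV" and R: "0 \<le> R" and u: "0 \<le> u" "u \<le> 1/2"
    and f: "gallager UNIV UNIV W p u \<le> exp f"
  shows "ereal (u * R - f) \<le> e_eps_p R W p"
proof -
  have "\<exists>\<Psi>. length \<Psi> = num_codewords R n \<and> set \<Psi> \<subseteq> seqs n \<and>
      eps_code (seqs n) (Wn W) \<Psi> (outdist (seqs n) (Wn W) (pn p))
        \<le> 3 * (real (num_codewords R n) powr - u * gallager (seqs n) (seqs n) (Wn W) (pn p) u)" for n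
    by (intro exists_code_eps_le pn_in_dists p Wn_nonneg W num_codewords_pos R u)
  then obtain \<Psi> where \<Psi>: "\<And>n. length (\<Psi> n) = num_codewords R n" "\<And>n. set (\<Psi> n) \<subseteq> seqs n"
    "\<And>n. eps_code (seqs n) (Wn W) (\<Psi> n) (outdist (seqs n) (Wn W) (pn p))
        \<le> 3 * (real (num_codewords R n) powr - u * gallager (seqs n) (seqs n) (Wn W) (pn p) u)"
    by metis
  \<comment> \<open>The constant 6 is 3 from the deviation bound times 2 from rounding.\<close>
  have "eps_code (seqs n) (Wn W) (\<Psi> n) (outdist (seqs n) (Wn W) (pn p))
      \<le> 6 * exp (- (real n * (u * R - f)))" for n
  proof -
    have "real (num_codewords R n) powr - u * gallager (seqs n) (seqs n) (Wn W) (pn p) u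
        \<le> 2 * exp (- (real n * (u * R - f)))"
      unfolding gallager_pn[OF W p]
      using u f by (intro code_bound_le_exp R power_mono zero_le_power gallager_nonneg) auto
    then show ?thesis using \<Psi>(3)[of n] by simp
  qed
  then have "ereal (u * R - f) \<le> liminf (\<lambda>n. rate n (ereal (eps_code (seqs n) (Wn W) (\<Psi> n)
      (outdist (seqs n) (Wn W) (pn p)))))"
    by (intro liminf_rate_ge[where C = 6]) (auto simp: eps_code_nonneg)
  also have "\<dots> \<le> e_eps_p R W p"
    unfolding e_eps_p_def by (rule SUP_upper[OF in_code_seqs[OF R \<Psi>(1,2)]])
  finally show ?thesis .
qed

lemma D_code_seqs_nonneg:
  fixes W :: "'x::finite \<Rightarrow> 'y::finite \<Rightarrow> real"
  assumes "channel W" "q \<in> dists (seqs n)" "\<Psi> \<noteq> []" "set \<Psi> \<subseteq> seqs n"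
  shows "0 \<le> D_code (seqs n) (Wn W) \<Psi> (outdist (seqs n) (Wn W) q)"
  using assms by (intro D_code_nonneg) (auto simp: Wn_nonneg sum_Wn)

text \<open>The one-shot constant \<open>1 / u\<close> requires \<open>u > 0\<close>; as
  \<open>u\<close> is fixed while \<open>n\<close> grows, it leaves the exponent unchanged.\<close>

lemma e_D_p_ge:
  fixes W :: "'x::finite \<Rightarrow> 'y::finite \<Rightarrow> real"
  assumes W: "channel W" and p: "p \<in> dists UNIV" and R: "0 \<le> R" and u: "0 < u" "u \<le> 1/2"
    and f: "gallager UNIV UNIV W p u \<le> exp f"
  shows "ereal (u * R - f) \<le> e_D_p R W p"
proof -
  have "\<exists>\<Psi>. length \<Psi> = num_codewords R n \<and> set \<Psi> \<subseteq> seqs n \<and>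
      D_code (seqs n) (Wn W) \<Psi> (outdist (seqs n) (Wn W) (pn p))
        \<le> ereal (real (num_codewords R n) powr - u * gallager (seqs n) (seqs n) (Wn W) (pn p) u / u)" for n
    using u by (intro exists_code_D_le pn_in_dists p Wn_nonneg W num_codewords_pos R) auto
  then obtain \<Psi> where \<Psi>: "\<And>n. length (\<Psi> n) = num_codewords R n" "\<And>n. set (\<Psi> n) \<subseteq> seqs n"
    "\<And>n. D_code (seqs n) (Wn W) (\<Psi> n) (outdist (seqs n) (Wn W) (pn p))
        \<le> ereal (real (num_codewords R n) powr - u * gallager (seqs n) (seqs n) (Wn W) (pn p) u / u)"
    by metis
  have "D_code (seqs n) (Wn W) (\<Psi> n) (outdist (seqs n) (Wn W) (pn p))
      \<le> ereal (2 / u * exp (- (real n * (u * R - f))))" for n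
  proof -
    have "real (num_codewords R n) powr - u * gallager (seqs n) (seqs n) (Wn W) (pn p) u
        \<le> 2 * exp (- (real n * (u * R - f)))"
      unfolding gallager_pn[OF W p]
      using u f by (intro code_bound_le_exp R power_mono zero_le_power gallager_nonneg) auto
    then have "real (num_codewords R n) powr - u * gallager (seqs n) (seqs n) (Wn W) (pn p) u / u
        \<le> 2 * exp (- (real n * (u * R - f))) / u"
      using u by (intro divide_right_mono) auto
    then show ?thesis by (intro order_trans[OF \<Psi>(3)]) simp
  qed
  moreover have "\<Psi> n \<noteq> []" for n using \<Psi>(1)[of n] num_codewords_pos[OF R, of n] by auto
  ultimately have "ereal (u * R - f) \<le> liminf (\<lambda>n. rate n (D_code (seqs n) (Wn W) (\<Psi> n)
      (outdist (seqs n) (Wn W) (pn p))))"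
    using u \<Psi>(2) by (intro liminf_rate_ge[where C = "2 / u"] D_code_seqs_nonneg W pn_in_dists p) auto
  also have "\<dots> \<le> e_D_p R W p"
    unfolding e_D_p_def by (rule SUP_upper[OF in_code_seqs[OF R \<Psi>(1,2)]])
  finally show ?thesis .
qed

lemma in_codes:
  assumes "0 \<le> R" "length \<Psi> = num_codewords R n" "set \<Psi> \<subseteq> A"
  shows "\<Psi> \<in> codes A (exp (real n * R))"
  using assms num_codewords_pos[of R n] num_codewords_le[of R n] by (auto simp: codes_def)

lemma gallager_Wn_le:
  fixes W :: "'x::finite \<Rightarrow> 'y::finite \<Rightarrow> real"
  assumes W: "channel W" and bound: "\<And>q. q \<in> dists UNIV \<Longrightarrow> gallager UNIV UNIV W q u \<le> \<Phi>" "0 \<le> \<Phi>"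
    and q: "q \<in> dists (seqs n)"
  shows "gallager (seqs n) (seqs n) (Wn W) q u \<le> \<Phi> ^ n"
  using gallager_Wn_unnormalised_le[where q = q and n = n, OF W bound distsD(1)[OF q]] distsD(2)[OF q] by simp

text \<open>The maximum runs over all inputs on sequences, not only products, so the single-letter
  bound is required for every \<open>q\<close>.\<close>

lemma e_eps_ge:
  fixes W :: "'x::finite \<Rightarrow> 'y::finite \<Rightarrow> real"
  assumes W: "channel W" and p: "p \<in> dists (UNIV :: 'x set)" and R: "0 \<le> R"
    and u: "0 \<le> u" "u \<le> 1/2"
    and f: "\<And>q. q \<in> dists UNIV \<Longrightarrow> gallager UNIV UNIV W q u \<le> exp f"
  shows "ereal (u * R - f) \<le> e_eps R W"
  unfolding e_eps_def
proof (rule liminf_rate_ge[where C = 6])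
  fix n
  \<comment> \<open>\<open>pn p\<close> supplies one input distribution, so the supremum lies above
    a nonnegative infimum.\<close>
  have "0 \<le> (INF \<Psi>\<in>codes (seqs n) (exp (real n * R)).
      ereal (eps_code (seqs n) (Wn W) \<Psi> (outdist (seqs n) (Wn W) (pn p))))"
    by (auto intro!: INF_greatest simp: eps_code_nonneg)
  also have "\<dots> \<le> eps_M (seqs n) (seqs n) (Wn W) (exp (real n * R))"
    unfolding eps_M_def by (rule SUP_upper[OF pn_in_dists[OF p]])
  finally show "0 \<le> eps_M (seqs n) (seqs n) (Wn W) (exp (real n * R))" .
  show "eps_M (seqs n) (seqs n) (Wn W) (exp (real n * R)) \<le> ereal (6 * exp (- (real n * (u * R - f))))"
    unfolding eps_M_def
  proof (rule SUP_least)
    fix q :: "'x list \<Rightarrow> real" assume q: "q \<in> dists (seqs n)"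
    obtain \<Psi> where \<Psi>: "length \<Psi> = num_codewords R n" "set \<Psi> \<subseteq> seqs n"
      "eps_code (seqs n) (Wn W) \<Psi> (outdist (seqs n) (Wn W) q)
        \<le> 3 * (real (num_codewords R n) powr - u * gallager (seqs n) (seqs n) (Wn W) q u)"
      using exists_code_eps_le[where B = "seqs n" and V = "Wn W", OF q Wn_nonneg[OF W]
          num_codewords_pos[OF R] u] by blast
    have "real (num_codewords R n) powr - u * gallager (seqs n) (seqs n) (Wn W) q u
        \<le> 2 * exp (- (real n * (u * R - f)))"
      using u by (intro code_bound_le_exp R gallager_nonneg gallager_Wn_le[OF W f _ q]) auto
    with \<Psi>(3) have "eps_code (seqs n) (Wn W) \<Psi> (outdist (seqs n) (Wn W) q)
        \<le> 6 * exp (- (real n * (u * R - f)))" by simp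
    then show "(INF \<Psi>\<in>codes (seqs n) (exp (real n * R)).
        ereal (eps_code (seqs n) (Wn W) \<Psi> (outdist (seqs n) (Wn W) q)))
      \<le> ereal (6 * exp (- (real n * (u * R - f))))"
      by (intro INF_lower2[OF in_codes[OF R \<Psi>(1,2)]]) simp
  qed
qed simp

lemma e_D_ge:
  fixes W :: "'x::finite \<Rightarrow> 'y::finite \<Rightarrow> real"
  assumes W: "channel W" and p: "p \<in> dists (UNIV :: 'x set)" and R: "0 \<le> R"
    and u: "0 < u" "u \<le> 1/2"
    and f: "\<And>q. q \<in> dists UNIV \<Longrightarrow> gallager UNIV UNIV W q u \<le> exp f"
  shows "ereal (u * R - f) \<le> e_D R W"
  unfolding e_D_def
proof (rule liminf_rate_ge[where C = "2 / u"])
  fix n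
  have "0 \<le> (INF \<Psi>\<in>codes (seqs n) (exp (real n * R)).
      D_code (seqs n) (Wn W) \<Psi> (outdist (seqs n) (Wn W) (pn p)))"
    by (intro INF_greatest D_code_seqs_nonneg W pn_in_dists p) (auto simp: codes_def)
  also have "\<dots> \<le> D_M (seqs n) (seqs n) (Wn W) (exp (real n * R))"
    unfolding D_M_def by (rule SUP_upper[OF pn_in_dists[OF p]])
  finally show "0 \<le> D_M (seqs n) (seqs n) (Wn W) (exp (real n * R))" .
  show "D_M (seqs n) (seqs n) (Wn W) (exp (real n * R)) \<le> ereal (2 / u * exp (- (real n * (u * R - f))))"
    unfolding D_M_def
  proof (rule SUP_least)
    fix q :: "'x list \<Rightarrow> real" assume q: "q \<in> dists (seqs n)"
    have "u < 1" using u by simp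
    obtain \<Psi> where \<Psi>: "length \<Psi> = num_codewords R n" "set \<Psi> \<subseteq> seqs n"
      "D_code (seqs n) (Wn W) \<Psi> (outdist (seqs n) (Wn W) q)
        \<le> ereal (real (num_codewords R n) powr - u * gallager (seqs n) (seqs n) (Wn W) q u / u)"
      using exists_code_D_le[where B = "seqs n" and V = "Wn W", OF q Wn_nonneg[OF W]
          num_codewords_pos[OF R] u(1) \<open>u < 1\<close>] by blast
    have "real (num_codewords R n) powr - u * gallager (seqs n) (seqs n) (Wn W) q u
        \<le> 2 * exp (- (real n * (u * R - f)))"
      using u by (intro code_bound_le_exp R gallager_nonneg gallager_Wn_le[OF W f _ q]) auto
    then have "real (num_codewords R n) powr - u * gallager (seqs n) (seqs n) (Wn W) q u / u
        \<le> 2 * exp (- (real n * (u * R - f))) / u"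
      using u by (intro divide_right_mono) auto
    then show "(INF \<Psi>\<in>codes (seqs n) (exp (real n * R)).
        D_code (seqs n) (Wn W) \<Psi> (outdist (seqs n) (Wn W) q))
      \<le> ereal (2 / u * exp (- (real n * (u * R - f))))"
      by (intro INF_lower2[OF in_codes[OF R \<Psi>(1,2)]] order_trans[OF \<Psi>(3)]) simp
  qed
qed (use u in simp)

section \<open>Single-letter comparison\<close>

text \<open>One input of nonzero mass and one output it can produce already give a positive term.
  Positivity is what lets \<open>exp\<close> undo the logarithm in \<open>phi\<close>.\<close>

lemma gallager_pos:
  fixes W :: "'x::finite \<Rightarrow> 'y::finite \<Rightarrow> real"
  assumes W: "channel W" and p: "p \<in> dists UNIV"
  shows "0 < gallager UNIV UNIV W p u"
proof -
  obtain x where x: "p x \<noteq> 0" using distsD(2)[OF p] by (metis sum.neutral zero_neq_one)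
  obtain y where y: "W x y \<noteq> 0" using channelD(2)[OF W, of x] by (metis sum.neutral zero_neq_one)
  have "0 < p x * W x y powr (1 / (1 - u))"
    using x y distsD(1)[OF p, of x] by simp
  also have "\<dots> \<le> (\<Sum>x\<in>UNIV. p x * W x y powr (1 / (1 - u)))"
    using distsD(1)[OF p] by (intro member_le_sum) auto
  finally have "0 < (\<Sum>x\<in>UNIV. p x * W x y powr (1 / (1 - u))) powr (1 - u)" by simp
  also have "\<dots> \<le> gallager UNIV UNIV W p u"
    unfolding gallager_def by (rule member_le_sum) auto
  finally show ?thesis .
qed

lemma gallager_eq_exp_phi:
  fixes W :: "'x::finite \<Rightarrow> 'y::finite \<Rightarrow> real"
  assumes "channel W" "p \<in> dists UNIV"
  shows "gallager UNIV UNIV W p u = exp (phi (- u) W p)"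
  using gallager_pos[OF assms, of u] by (simp add: phi_def gallager_def)

text \<open>Probabilities do not exceed 1, so a power at least 1 only shrinks them.\<close>

lemma sum_powr_le_Wp:
  fixes W :: "'x::finite \<Rightarrow> 'y::finite \<Rightarrow> real"
  assumes W: "channel W" and p: "p \<in> dists UNIV" and a: "1 \<le> a"
  shows "(\<Sum>x\<in>UNIV. p x * W x y powr a) \<le> Wp W p y"
  unfolding Wp_def
proof (intro sum_mono mult_left_mono)
  fix x
  show "W x y powr a \<le> W x y"
    using powr_mono'[OF a channelD(1)[OF W] channel_le_one[OF W], of x y] channelD(1)[OF W, of x y] by simp
qed (use distsD(1)[OF p] in auto)

lemma sum_Wp:
  fixes W :: "'x::finite \<Rightarrow> 'y::finite \<Rightarrow> real"
  assumes W: "channel W" and p: "p \<in> dists UNIV"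
  shows "(\<Sum>y\<in>UNIV. Wp W p y) = 1"
proof -
  have "(\<Sum>y\<in>UNIV. Wp W p y) = (\<Sum>x\<in>UNIV. p x * (\<Sum>y\<in>UNIV. W x y))"
    unfolding Wp_def sum_distrib_left by (rule sum.swap)
  then show ?thesis using channelD(2)[OF W] distsD(2)[OF p] by simp
qed

lemma Wp_nonneg:
  assumes "channel W" "p \<in> dists UNIV"
  shows "0 \<le> Wp W p y"
  using channelD(1)[OF assms(1)] distsD(1)[OF assms(2)] by (auto simp: Wp_def intro!: sum_nonneg)

text \<open>Hoelder against the constant 1. The exponent is uniform in the input and tends to 0 with
  \<open>u\<close>: the first makes the supremum of \<open>phi\<close> meaningful, the second
  settles \<open>t = 0\<close>.\<close>

lemma gallager_le_card:
  fixes W :: "'x::finite \<Rightarrow> 'y::finite \<Rightarrow> real"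
  assumes W: "channel W" and p: "p \<in> dists UNIV" and u: "0 \<le> u" "u < 1"
  shows "gallager UNIV UNIV W p u \<le> exp (u * ln (real CARD('y)))"
proof -
  define T where "T = (\<lambda>y. \<Sum>x\<in>UNIV. p x * W x y powr (1 / (1 - u)))"
  have T: "0 \<le> T y" for y using distsD(1)[OF p] by (auto simp: T_def intro!: sum_nonneg)
  have "sum T UNIV \<le> (\<Sum>y\<in>UNIV. Wp W p y)"
    unfolding T_def using u by (intro sum_mono sum_powr_le_Wp W p) (auto simp: field_simps)
  then have "sum T UNIV \<le> 1" by (simp add: sum_Wp W p)
  have "gallager UNIV UNIV W p u = (\<Sum>y\<in>UNIV. T y powr (1 - u) * 1 powr u)"
    by (simp add: gallager_def T_def)
  also have "\<dots> \<le> sum T UNIV powr (1 - u) * (\<Sum>y\<in>(UNIV :: 'y set). 1) powr u"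
    using u T by (intro holder_powr) auto
  also have "\<dots> \<le> 1 powr (1 - u) * real CARD('y) powr u"
    using u \<open>sum T UNIV \<le> 1\<close> by (intro mult_mono powr_mono2) (auto intro!: sum_nonneg T)
  also have "\<dots> = exp (u * ln (real CARD('y)))" by (simp add: powr_def)
  finally show ?thesis .
qed

text \<open>For \<open>u = s / (1 + s)\<close> the inner exponent \<open>1 / (1 - u)\<close> is
  \<open>1 + s\<close>, and \<open>s * (1 - u) = u\<close> lets Hoelder distribute powers of
  \<open>Wp\<close>, whose total mass 1 then drops out. The second bound replaces \<open>Wp\<close>
  by the smaller \<open>T\<close> under a negative power.\<close>

lemma gallager_le_psi_p:
  fixes W :: "'x::finite \<Rightarrow> 'y::finite \<Rightarrow> real"
  assumes W: "channel W" and p: "p \<in> dists UNIV" and s: "0 \<le> s"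
  shows "gallager UNIV UNIV W p (s / (1 + s)) \<le> exp (psi_p s W p / (1 + s))"
    and "exp (psi_p s W p) \<le> (\<Sum>y\<in>UNIV. (\<Sum>x\<in>UNIV. p x * W x y powr (1 + s)) powr (1 - s))"
proof -
  define u where "u = s / (1 + s)"
  define T where "T = (\<lambda>y. \<Sum>x\<in>UNIV. p x * W x y powr (1 + s))"
  define K where "K = (\<Sum>y\<in>UNIV. T y * Wp W p y powr (- s))"
  have u: "0 \<le> u" "u < 1" "1 / (1 - u) = 1 + s" "1 - u = 1 / (1 + s)" "s * (1 - u) = u"
    using s by (auto simp: u_def field_simps)
  have T: "0 \<le> T y" for y using distsD(1)[OF p] by (auto simp: T_def intro!: sum_nonneg)
  have T_le: "T y \<le> Wp W p y" for y
    unfolding T_def using s by (intro sum_powr_le_Wp W p) auto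
  have psi: "psi_p s W p = ln K"
  proof -
    have "(\<Sum>x\<in>UNIV. p x * (\<Sum>y\<in>UNIV. W x y powr (1 + s) * Wp W p y powr (- s))) = K"
      unfolding K_def T_def sum_distrib_left sum_distrib_right by (subst sum.swap) (simp add: mult_ac)
    then show ?thesis by (simp add: psi_p_def)
  qed
  have "gallager UNIV UNIV W p u = (\<Sum>y\<in>UNIV. T y powr (1 - u))"
    by (simp add: gallager_def T_def u(3))
  also have "\<dots> = (\<Sum>y\<in>UNIV. (T y * Wp W p y powr (- s)) powr (1 - u) * Wp W p y powr u)"
  proof (rule sum.cong[OF refl])
    fix y
    show "T y powr (1 - u) = (T y * Wp W p y powr (- s)) powr (1 - u) * Wp W p y powr u"
    proof (cases "Wp W p y = 0")
      \<comment> \<open>An output of probability 0 has \<open>T y = 0\<close> as well, and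
        \<open>powr\<close> of base 0 is 0 on both sides.\<close>
      case True
      then have "T y = 0" using T[of y] T_le[of y] by simp
      then show ?thesis by simp
    next
      case False
      then have "0 < Wp W p y" using Wp_nonneg[OF W p, of y] by simp
      then have "(Wp W p y powr (- s)) powr (1 - u) * Wp W p y powr u = 1"
        by (simp add: powr_powr u(5) powr_add[symmetric])
      then show ?thesis using T[of y] by (simp add: powr_mult mult.assoc)
    qed
  qed
  also have "\<dots> \<le> K powr (1 - u) * (\<Sum>y\<in>UNIV. Wp W p y) powr u"
    unfolding K_def using u(1,2) T Wp_nonneg[OF W p] by (intro holder_powr) auto
  finally have le: "gallager UNIV UNIV W p u \<le> K powr (1 - u)" by (simp add: sum_Wp W p)
  \<comment> \<open>Positivity of \<open>K\<close> is inherited from the functional it dominates,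
    and is needed to leave \<open>psi_p = ln K\<close> through \<open>exp\<close>.\<close>
  then have "0 < K powr (1 - u)" using gallager_pos[OF W p, of u] by linarith
  moreover have "0 \<le> K" using T by (auto simp: K_def intro!: sum_nonneg)
  ultimately have K: "0 < K" by (auto simp: less_le)
  then have "K powr (1 - u) = exp (psi_p s W p / (1 + s))"
    unfolding psi by (simp add: powr_def u(4))
  with le show "gallager UNIV UNIV W p (s / (1 + s)) \<le> exp (psi_p s W p / (1 + s))"
    by (simp add: u_def)
  have "K \<le> (\<Sum>y\<in>UNIV. T y powr (1 - s))"
    unfolding K_def
  proof (rule sum_mono)
    fix y
    show "T y * Wp W p y powr (- s) \<le> T y powr (1 - s)"
    proof (cases "T y = 0")
      case False
      then have pos: "0 < T y" using T[of y] by simp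
      have "T y * Wp W p y powr (- s) \<le> T y * T y powr (- s)"
        using pos s T_le[of y] by (intro mult_left_mono powr_mono2') auto
      also have "\<dots> = T y powr (1 - s)"
        using pos by (simp add: powr_mult_base)
      finally show ?thesis .
    qed simp
  qed
  then show "exp (psi_p s W p) \<le> (\<Sum>y\<in>UNIV. (\<Sum>x\<in>UNIV. p x * W x y powr (1 + s)) powr (1 - s))"
    using K by (simp add: psi T_def)
qed

text \<open>The second bound on \<open>psi_p\<close> places it below \<open>psi\<close>, since the
  supremum in \<open>psi\<close> includes the value at \<open>p\<close>.\<close>

lemma gallager_le_psi:
  fixes W :: "'x::finite \<Rightarrow> 'y::finite \<Rightarrow> real"
  assumes W: "channel W" and p: "p \<in> dists UNIV" and s: "0 \<le> s" "s \<le> 1"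
  shows "gallager UNIV UNIV W p (s / (1 + s)) \<le> exp (psi s W / (1 + s))"
proof -
  define G where "G = (\<lambda>p. \<Sum>y\<in>UNIV. (\<Sum>x\<in>UNIV. p x * W x y powr (1 + s)) powr (1 - s))"
  \<comment> \<open>A real \<open>Sup\<close> dominates its set only when the set is bounded above;
    here each summand is at most 1, using \<open>s <= 1\<close>.\<close>
  have "G q \<le> real CARD('y)" if q: "q \<in> dists UNIV" for q
  proof -
    have "(\<Sum>x\<in>UNIV. q x * W x y powr (1 + s)) powr (1 - s) \<le> 1" for y
    proof -
      have "0 \<le> (\<Sum>x\<in>UNIV. q x * W x y powr (1 + s))"
        using distsD(1)[OF q] by (auto intro!: sum_nonneg)
      moreover have "(\<Sum>x\<in>UNIV. q x * W x y powr (1 + s)) \<le> Wp W q y"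
        using s by (intro sum_powr_le_Wp W q) auto
      moreover have "Wp W q y \<le> (\<Sum>y\<in>UNIV. Wp W q y)"
        using Wp_nonneg[OF W q] by (intro member_le_sum) auto
      ultimately show ?thesis using s by (intro powr_le1) (auto simp: sum_Wp W q)
    qed
    then have "G q \<le> (\<Sum>y\<in>(UNIV :: 'y set). 1)" unfolding G_def by (intro sum_mono)
    then show ?thesis by simp
  qed
  then have "bdd_above (G ` dists UNIV)" by (intro bdd_aboveI2)
  then have "G p \<le> Sup (G ` dists UNIV)" using p by (intro cSup_upper) auto
  with gallager_le_psi_p(2)[OF W p s(1)] have le: "exp (psi_p s W p) \<le> Sup (G ` dists UNIV)"
    unfolding G_def by linarith
  then have "0 < Sup (G ` dists UNIV)" using exp_gt_zero[of "psi_p s W p"] by linarith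
  moreover have "psi s W = ln (Sup (G ` dists UNIV))" by (simp add: psi_def G_def)
  ultimately have "psi_p s W p \<le> psi s W" using le by (simp add: ln_ge_iff)
  then have "exp (psi_p s W p / (1 + s)) \<le> exp (psi s W / (1 + s))"
    using s by (simp add: divide_right_mono)
  with gallager_le_psi_p(1)[OF W p s(1)] show ?thesis by linarith
qed

text \<open>The bound \<open>u * ln (real CARD('y))\<close>, uniform in the input, ensures that the
  real \<open>Sup\<close> is an upper bound.\<close>

lemma gallager_le_Sup_phi:
  fixes W :: "'x::finite \<Rightarrow> 'y::finite \<Rightarrow> real"
  assumes W: "channel W" and p: "p \<in> dists UNIV" and u: "0 \<le> u" "u < 1"
  shows "gallager UNIV UNIV W p u \<le> exp (Sup ((\<lambda>q. phi (- u) W q) ` dists UNIV))"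
proof -
  have "phi (- u) W q \<le> u * ln (real CARD('y))" if "q \<in> dists UNIV" for q
    using gallager_le_card[OF W that u] by (simp add: gallager_eq_exp_phi[OF W that])
  then have "bdd_above ((\<lambda>q. phi (- u) W q) ` dists UNIV)" by (intro bdd_aboveI2)
  then have "phi (- u) W p \<le> Sup ((\<lambda>q. phi (- u) W q) ` dists UNIV)"
    using p by (intro cSup_upper) auto
  then show ?thesis by (simp add: gallager_eq_exp_phi[OF W p])
qed

lemma phi_0:
  fixes W :: "'x::finite \<Rightarrow> 'y::finite \<Rightarrow> real"
  assumes W: "channel W" and p: "p \<in> dists UNIV"
  shows "phi 0 W p = 0"
proof -
  have "(\<Sum>y\<in>UNIV. (\<Sum>x\<in>UNIV. p x * W x y powr 1) powr 1) = (\<Sum>y\<in>UNIV. Wp W p y)"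
    using Wp_nonneg[OF W p] channelD(1)[OF W] by (simp add: Wp_def)
  then show ?thesis by (simp add: phi_def sum_Wp W p)
qed

text \<open>The relative entropy bounds degenerate at \<open>u = 0\<close> (the constant is \<open>1 / u\<close>); the claim at
  \<open>t = 0\<close> is recovered in the limit.\<close>

lemma ereal_nonneg_if_ge_small_multiples:
  assumes "\<And>u::real. 0 < u \<Longrightarrow> u \<le> 1/2 \<Longrightarrow> ereal (- (u * c)) \<le> x"
  shows "0 \<le> x"
proof (rule tendsto_upperbound)
  have "((\<lambda>u. - (u * c)) \<longlongrightarrow> - (0 * c)) (at_right 0)" by (intro tendsto_intros)
  then show "((\<lambda>u. ereal (- (u * c))) \<longlongrightarrow> 0) (at_right (0::real))"
    unfolding zero_ereal_def by (intro tendsto_ereal) simp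
  show "\<forall>\<^sub>F u in at_right (0::real). ereal (- (u * c)) \<le> x"
    unfolding eventually_at_right_field using assms by (intro exI[of _ "1/2"]) auto
qed simp

theorem theorem10:
  fixes W :: "'x::finite \<Rightarrow> 'y::finite \<Rightarrow> real" and p :: "'x \<Rightarrow> real" and R :: real
  assumes "channel W" and "p \<in> dists UNIV" and "0 \<le> R"
  shows "(SUP s\<in>{0..1}. ereal ((- psi_p s W p + s * R) / (1 + s))) \<le> e_eps_p R W p \<and>
         (SUP t\<in>{-1/2..0}. ereal (- phi t W p - t * R)) \<le> e_D_p R W p \<and>
         (SUP s\<in>{0..1}. ereal ((- psi s W + s * R) / (1 + s))) \<le> e_eps R W \<and>
         (SUP t\<in>{-1/2..0}. ereal (- Sup ((\<lambda>q. phi t W q) ` dists UNIV) - t * R)) \<le> e_D R W"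
proof (intro conjI SUP_least)
  note W = assms(1) and p = assms(2) and R = assms(3)
  \<comment> \<open>Both identities bring the claims to the form \<open>u * R - f\<close>, with
    \<open>u = s / (1 + s)\<close> or \<open>u = - t\<close>; the ranges of \<open>s\<close> and
    \<open>t\<close> give \<open>u <= 1/2\<close>.\<close>
  have exponent: "(- a + s * R) / (1 + s) = s / (1 + s) * R - a / (1 + s)" for a s
    by (simp add: diff_divide_distrib)
  have exponent_D: "- a - t * R = - t * R - a" for a t
    by simp
  {
    fix s :: real assume s: "s \<in> {0..1}"
    then have u: "0 \<le> s / (1 + s)" "s / (1 + s) \<le> 1/2" by (auto simp: field_simps)
    show "ereal ((- psi_p s W p + s * R) / (1 + s)) \<le> e_eps_p R W p"
      unfolding exponent using s by (intro e_eps_p_ge W p R u gallager_le_psi_p) auto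
    show "ereal ((- psi s W + s * R) / (1 + s)) \<le> e_eps R W"
      unfolding exponent using s by (intro e_eps_ge[OF W p R u] gallager_le_psi W) auto
  next
    fix t :: real assume t: "t \<in> {-1/2..0}"
    \<comment> \<open>Preparation for \<open>t = 0\<close>: the cardinality bound holds for each
      small positive \<open>u\<close>, and the nonnegative term \<open>u * R\<close> is
      dropped.\<close>
    have small: "ereal (- (u * ln (real CARD('y)))) \<le> e_D_p R W p"
      "ereal (- (u * ln (real CARD('y)))) \<le> e_D R W" if "0 < u" "u \<le> 1/2" for u
    proof -
      have "- (u * ln (real CARD('y))) \<le> u * R - u * ln (real CARD('y))" using R that by simp
      moreover have "ereal (u * R - u * ln (real CARD('y))) \<le> e_D_p R W p"
        using that by (intro e_D_p_ge W p R gallager_le_card) auto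
      moreover have "ereal (u * R - u * ln (real CARD('y))) \<le> e_D R W"
        using that by (intro e_D_ge[OF W p R] gallager_le_card W) auto
      ultimately show "ereal (- (u * ln (real CARD('y)))) \<le> e_D_p R W p"
        "ereal (- (u * ln (real CARD('y)))) \<le> e_D R W"
        by (meson ereal_less_eq(3) order_trans)+
    qed
    show "ereal (- phi t W p - t * R) \<le> e_D_p R W p"
    proof (cases "t = 0")
      case True
      then show ?thesis
        using ereal_nonneg_if_ge_small_multiples[OF small(1)] phi_0[OF W p]
        by (simp flip: zero_ereal_def)
    next
      case False
      then have u: "0 < - t" "- t \<le> 1/2" using t by auto
      have "gallager UNIV UNIV W p (- t) \<le> exp (phi t W p)"
        by (simp add: gallager_eq_exp_phi[OF W p])
      from e_D_p_ge[OF W p R u this] show ?thesis unfolding exponent_D .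
    qed
    show "ereal (- Sup ((\<lambda>q. phi t W q) ` dists UNIV) - t * R) \<le> e_D R W"
    proof (cases "t = 0")
      case True
      \<comment> \<open>The given \<open>p\<close> makes the set of inputs nonempty, so the supremum
        at \<open>t = 0\<close> is exactly 0.\<close>
      have "(\<lambda>q. phi 0 W q) ` dists UNIV = {0}"
        using p phi_0[OF W] by (auto simp: image_iff intro!: bexI[of _ p])
      then show ?thesis
        using True ereal_nonneg_if_ge_small_multiples[OF small(2)]
        by (simp flip: zero_ereal_def)
    next
      case False
      then have u: "0 < - t" "- t \<le> 1/2" using t by auto
      have "gallager UNIV UNIV W q (- t) \<le> exp (Sup ((\<lambda>q. phi t W q) ` dists UNIV))"
        if "q \<in> dists UNIV" for q
        using gallager_le_Sup_phi[OF W that, of "- t"] u by simp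
      from e_D_ge[OF W p R u this] show ?thesis unfolding exponent_D .
    qed
  }
qed

end
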